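(* Let $k$ be an infinite field, let $R=k[x_1,\dots,x_s]$ be a standard graded polynomial ring with maximal homogeneous ideal $\mathfrak m$, let $g_1,\dots,g_n$ be $k$-linearly independent homogeneous forms of degree $d$ in $R$, and let $I=(g_1,\dots,g_n)$. Let $A=k[I_d]$ and $B=k[R_d]$. If $I$ is $\mathfrak m$-primary, then $$d^{s-1}=e(A)\,[B:A].$$
   Context: $A\subset B$ are regraded to be standard graded $k$-algebras. $[B:A]=[\operatorname{Quot}(B):\operatorname{Quot}(A)]$; this is the degree of the rational map $[g_1:\dots:g_n]:\mathbb P^{s-1}_k\dashrightarrow\mathbb P^{n-1}_k$ onto its image. $e(A)$ is the multiplicity of the standard graded $k$-algebra $A$ with respect to its maximal homogeneous ideal. *)

theory Defs
  imports
    "HOL-Algebra.Algebra"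
    "HOL-Algebra.Algebraic_Closure_Type"
    "HOL-Library.Poly_Mapping"
    "HOL-Library.Extended_Real"
    "HOL-Computational_Algebra.Fraction_Field"
begin

section \<open>Polynomial rings in finitely many variables\<close>

text \<open>
  Exponent vectors are finitely supported maps \<^typ>\<open>nat \<Rightarrow>\<^sub>0 nat\<close>, polynomials are finitely
  supported maps from exponent vectors to coefficients, with convolution as product.
  The polynomial ring \<open>k[x\<^sub>0, \<dots>, x\<^sub>s\<^sub>-\<^sub>1]\<close> is cut out by the carrier; \<open>k\<close> is a type.
\<close>

type_synonym 'k mpol = "(nat \<Rightarrow>\<^sub>0 nat) \<Rightarrow>\<^sub>0 'k"

definition mpol_ring :: "nat \<Rightarrow> ('k::field) mpol ring" where
  "mpol_ring s = ring_of_type_algebra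
     \<lparr> carrier := {p. \<forall>m \<in> Poly_Mapping.keys p. Poly_Mapping.keys m \<subseteq> {..<s}} \<rparr>"

definition constants :: "('k::field) mpol set" where
  "constants = range (Poly_Mapping.single 0)"

definition mvar :: "nat \<Rightarrow> ('k::field) mpol" where
  "mvar i = Poly_Mapping.single (Poly_Mapping.single i 1) 1"

definition exp_deg :: "(nat \<Rightarrow>\<^sub>0 nat) \<Rightarrow> nat" where
  "exp_deg m = (\<Sum>i\<in>Poly_Mapping.keys m. Poly_Mapping.lookup m i)"

text \<open>The homogeneous component \<open>R\<^sub>d\<close>; it contains the zero polynomial.\<close>

definition homog_part :: "nat \<Rightarrow> nat \<Rightarrow> ('k::field) mpol set" where
  "homog_part s d =
     {p \<in> carrier (mpol_ring s). \<forall>m \<in> Poly_Mapping.keys p. exp_deg m = d}"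

definition max_homog_ideal :: "nat \<Rightarrow> ('k::field) mpol set" where
  "max_homog_ideal s = Idl\<^bsub>mpol_ring s\<^esub> (mvar ` {..<s})"

text \<open>The subalgebra \<open>k[S]\<close> of the polynomial ring, as a ring in its own right.\<close>

definition subalg_ring :: "nat \<Rightarrow> ('k::field) mpol set \<Rightarrow> 'k mpol ring" where
  "subalg_ring s S =
     (mpol_ring s) \<lparr> carrier := generate_ring (mpol_ring s) (constants \<union> S) \<rparr>"


section \<open>Primary ideals\<close>

definition radical :: "('a, 'b) ring_scheme \<Rightarrow> 'a set \<Rightarrow> 'a set" where
  "radical R I = {a \<in> carrier R. \<exists>n::nat. a [^]\<^bsub>R\<^esub> n \<in> I}"

definition primary_ideal :: "'a set \<Rightarrow> ('a, 'b) ring_scheme \<Rightarrow> bool" where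
  "primary_ideal Q R \<longleftrightarrow> ideal Q R \<and> Q \<noteq> carrier R \<and>
     (\<forall>a \<in> carrier R. \<forall>b \<in> carrier R. a \<otimes>\<^bsub>R\<^esub> b \<in> Q \<longrightarrow> a \<in> Q \<or> b \<in> radical R Q)"

definition primary_to :: "'a set \<Rightarrow> 'a set \<Rightarrow> ('a, 'b) ring_scheme \<Rightarrow> bool" where
  "primary_to P Q R \<longleftrightarrow> primary_ideal Q R \<and> radical R Q = P"


section \<open>Krull dimension, length and multiplicity\<close>

definition chain_sup :: "('a set \<Rightarrow> bool) \<Rightarrow> enat" where
  "chain_sup P = Sup {enat n | n. \<exists>c :: nat \<Rightarrow> 'a set.
     (\<forall>i\<le>n. P (c i)) \<and> (\<forall>i<n. c i \<subset> c (Suc i))}"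

definition krull_dim :: "('a, 'b) ring_scheme \<Rightarrow> enat" where
  "krull_dim R = chain_sup (\<lambda>P. primeideal P R)"

text \<open>
  The length of a commutative ring as a module over itself. For an ideal \<open>J\<close> of \<open>R\<close>, the
  \<open>R\<close>-submodules of \<open>R/J\<close> are the ideals of the ring \<open>R Quot J\<close>, so
  \<open>ring_length (R Quot J)\<close> is the length of the \<open>R\<close>-module \<open>R/J\<close>.
\<close>

definition ring_length :: "('a, 'b) ring_scheme \<Rightarrow> enat" where
  "ring_length R = chain_sup (\<lambda>I. ideal I R)"

text \<open>
  The Hilbert--Samuel multiplicity of \<open>R\<close> with respect to \<open>J\<close>:
  the limit of \<open>D! \<cdot> length(R/J\<^sup>n) / n\<^sup>D\<close> for \<open>D = dim R\<close>.
  Powers of ideals are taken in the semiring of ideals.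
\<close>

definition multiplicity_wrt :: "('a, 'b) ring_scheme \<Rightarrow> 'a set \<Rightarrow> real" where
  "multiplicity_wrt R J =
     lim (\<lambda>n::nat. fact (the_enat (krull_dim R)) *
            real (the_enat (ring_length (R Quot (J [^]\<^bsub>ideals_set R\<^esub> n)))) /
            real n ^ the_enat (krull_dim R))"

text \<open>
  The maximal homogeneous ideal of a graded subalgebra \<open>A\<close> with \<open>A\<^sub>0 = k\<close> consists of its
  elements without constant term; regrading \<open>A\<close> does not affect it.
\<close>

definition graded_multiplicity :: "nat \<Rightarrow> ('k::field) mpol ring \<Rightarrow> real" where
  "graded_multiplicity s A = multiplicity_wrt A (carrier A \<inter> max_homog_ideal s)"


section \<open>Degree of an extension of domains\<close>

text \<open>The quotient field of a subring of a domain, inside the quotient field of that domain.\<close>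

definition quot_field :: "('a::idom) set \<Rightarrow> 'a fract set" where
  "quot_field S = {Fract a b | a b. a \<in> S \<and> b \<in> S \<and> b \<noteq> 0}"

definition field_degree :: "('a, 'b) ring_scheme \<Rightarrow> 'a set \<Rightarrow> 'a set \<Rightarrow> enat" where
  "field_degree F K L =
     (if ring.finite_dimension F K L then enat (ring.dim F K L) else \<infinity>)"

definition domain_degree :: "('a::idom) ring \<Rightarrow> 'a ring \<Rightarrow> enat" where
  "domain_degree A B =
     field_degree ring_of_type_algebra (quot_field (carrier A)) (quot_field (carrier B))"

end

theory Submission
  imports Defs
begin

text \<open>
  Write \<open>V = I \<inter> R\<^sub>d\<close>, so that \<open>A = k[V]\<close> is graded by the spaces spanned by the \<open>j\<close>-fold products
  of elements of \<open>V\<close>, just as \<open>B = k[R\<^sub>d]\<close> is graded by the spaces \<open>R\<^sub>j\<^sub>d\<close>.  The theorem is a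
  comparison of the growth of these two graded algebras; no Hilbert polynomial is needed, only the
  leading term of the dimension of the elements of degree below \<open>n\<close>.

  Since \<open>I\<close> contains powers of all variables, every form of large degree lies in \<open>I\<close>, whence
  \<open>R\<^sub>t = V R\<^bsub>t-d\<^esub>\<close> for large \<open>t\<close>.  So \<open>R\<close> is a finite module over \<open>A\<close>, generated in bounded degree
  (\<open>primary_module_finite\<close>), and \<open>B\<close> is spanned over \<open>A\<close> by finitely many monomials.  A subset of
  these monomials is a basis of \<open>Quot B\<close> over \<open>Quot A\<close>; let \<open>r\<close> be its size (\<open>domain_degree_basis\<close>).
  Thus \<open>A\<^sup>r\<close> embeds into \<open>B\<close> and, after clearing denominators, \<open>q B\<close> embeds into \<open>A\<^sup>r\<close>, both with a
  bounded shift of degrees (\<open>rank_comparison\<close>).  The dimension of the elements of \<open>B\<close> of degree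
  below \<open>n\<close> is obtained by counting monomials and has leading term \<open>d\<^bsup>s-1\<^esup> n\<^sup>s / s!\<close>; hence \<open>r\<close> times
  the corresponding dimension for \<open>A\<close> has the same leading term.

  It remains to recognise the multiplicity in this growth.  First, the powers \<open>m\<^sup>n\<close> of the maximal
  homogeneous ideal \<open>m\<close> of \<open>A\<close> consist of the elements of order at least \<open>n\<close>, and \<open>A/m\<^sup>n\<close> has as length
  its dimension over \<open>k\<close> (\<open>ring_length_irrelevant_power\<close>).  Second, \<open>A\<close> has Krull dimension \<open>s\<close>
  (\<open>krull_dim_pieces\<close>), again by growth: each step in a chain of primes \<open>P \<subset> Q\<close> lowers the order of
  growth of the residue rings by at least one, and \<open>A\<close> itself grows at most like \<open>n\<^sup>s\<close>; conversely the
  contractions of the primes \<open>(x\<^sub>1, \<dots>, x\<^sub>i)\<close> of \<open>R\<close> are distinct because their residue rings grow with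
  distinct exponents.
\<close>

section \<open>Polynomials as vectors\<close>

definition smul :: "'k::field \<Rightarrow> 'k mpol \<Rightarrow> 'k mpol" where
  "smul c p = Poly_Mapping.single 0 c * p"

global_interpretation mp: vector_space smul
  by unfold_locales
    (simp_all add: smul_def distrib_left distrib_right single_add mult_single mult.assoc[symmetric])

lemma smul_mult_left: "smul c p * q = smul c (p * q)"
  by (simp add: smul_def mult.assoc)

lemma smul_mult_right: "p * smul c q = smul c (p * q)"
  by (simp add: smul_def mult.left_commute)

lemma lookup_smul: "Poly_Mapping.lookup (smul c p) m = c * Poly_Mapping.lookup p m"
  unfolding smul_def lookup_mult lookup_single
  by (simp add: when_mult eq_commute[of 0])

lemma smul_monom: "smul c (Poly_Mapping.single m a) = Poly_Mapping.single m (c * a)"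
  by (simp add: smul_def mult_single)

lemma keys_smul: "Poly_Mapping.keys (smul c p) \<subseteq> Poly_Mapping.keys p"
  by (auto simp: in_keys_iff lookup_smul)

lemma span_mult_closed:
  assumes "a \<in> mp.span S" "b \<in> mp.span T" "\<And>x y. x \<in> S \<Longrightarrow> y \<in> T \<Longrightarrow> x * y \<in> mp.span U"
  shows "a * b \<in> mp.span U"
proof -
  have 1: "x * b \<in> mp.span U" if "x \<in> S" for x
    using assms(2)
  proof (induction rule: mp.span_induct_alt)
    case base
    show ?case by (simp add: mp.span_zero)
  next
    case (step c y z)
    then show ?case
      using assms(3)[OF that] by (simp add: distrib_left smul_mult_right mp.span_add mp.span_scale)
  qed
  show ?thesis
    using assms(1)
  proof (induction rule: mp.span_induct_alt)
    case base
    show ?case by (simp add: mp.span_zero)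
  next
    case (step c x z)
    then show ?case
      using 1 by (simp add: distrib_right smul_mult_left mp.span_add mp.span_scale)
  qed
qed

subsection \<open>Monomials\<close>

abbreviation monom :: "(nat \<Rightarrow>\<^sub>0 nat) \<Rightarrow> ('k::field) mpol" where
  "monom m \<equiv> Poly_Mapping.single m 1"

lemma monom_expansion:
  "p = (\<Sum>m\<in>Poly_Mapping.keys p. smul (Poly_Mapping.lookup p m) (monom m))"
proof (rule poly_mapping_eqI)
  fix k
  have "(\<Sum>m\<in>Poly_Mapping.keys p. Poly_Mapping.lookup p m when m = k) = Poly_Mapping.lookup p k"
    by (simp add: when_def sum.delta' in_keys_iff)
  then show "Poly_Mapping.lookup p k = Poly_Mapping.lookup
      (\<Sum>m\<in>Poly_Mapping.keys p. smul (Poly_Mapping.lookup p m) (monom m)) k"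
    by (simp add: lookup_sum smul_monom lookup_single)
qed

lemma span_monom_iff: "p \<in> mp.span (monom ` M) \<longleftrightarrow> Poly_Mapping.keys p \<subseteq> M"
proof
  assume "p \<in> mp.span (monom ` M)"
  then show "Poly_Mapping.keys p \<subseteq> M"
  proof (induction rule: mp.span_induct_alt)
    case (step c x y)
    then show ?case
      using keys_add[of "smul c x" y] keys_smul[of c x] by (fastforce split: if_splits)
  qed simp
next
  assume *: "Poly_Mapping.keys p \<subseteq> M"
  show "p \<in> mp.span (monom ` M)"
    by (subst monom_expansion) (use * in \<open>auto intro!: mp.span_sum mp.span_scale intro: mp.span_base\<close>)
qed

lemma inj_monom: "inj (monom :: _ \<Rightarrow> ('k::field) mpol)"
  by (rule injI) (metis keys_single singleton_inject zero_neq_one)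

lemma independent_monom: "mp.independent (monom ` M :: ('k::field) mpol set)"
  unfolding mp.dependent_def
proof
  assume "\<exists>a\<in>monom ` M. (a :: 'k mpol) \<in> mp.span (monom ` M - {a})"
  then obtain m where "(monom m :: 'k mpol) \<in> mp.span (monom ` M - {monom m})" by blast
  then have "(monom m :: 'k mpol) \<in> mp.span (monom ` (M - {m}))"
    by (simp add: image_set_diff[OF inj_monom])
  then show False by (simp add: span_monom_iff)
qed

lemma exp_deg_superset:
  assumes "finite S" "Poly_Mapping.keys m \<subseteq> S"
  shows "exp_deg m = (\<Sum>i\<in>S. Poly_Mapping.lookup m i)"
  unfolding exp_deg_def
  by (rule sum.mono_neutral_left) (use assms in \<open>auto simp: in_keys_iff\<close>)

lemma exp_deg_add: "exp_deg (a + b) = exp_deg a + exp_deg b"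
proof -
  let ?S = "Poly_Mapping.keys a \<union> Poly_Mapping.keys b"
  have "exp_deg (a + b) = (\<Sum>i\<in>?S. Poly_Mapping.lookup (a + b) i)"
    by (rule exp_deg_superset) (auto simp: keys_add)
  also have "\<dots> = exp_deg a + exp_deg b"
    by (simp add: lookup_add sum.distrib exp_deg_superset[of ?S])
  finally show ?thesis .
qed

lemma exp_deg_zero [simp]: "exp_deg 0 = 0"
  by (simp add: exp_deg_def)

lemma exp_deg_single [simp]: "exp_deg (Poly_Mapping.single i a) = a"
  by (simp add: exp_deg_def)

lemma exp_deg_eq_zero: "exp_deg m = 0 \<longleftrightarrow> m = 0"
  by (auto simp: exp_deg_def in_keys_iff intro!: poly_mapping_eqI)

lemma keys_add_nat:
  fixes a b :: "nat \<Rightarrow>\<^sub>0 nat"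
  shows "Poly_Mapping.keys (a + b) = Poly_Mapping.keys a \<union> Poly_Mapping.keys b"
  by (auto simp: in_keys_iff lookup_add)

text \<open>Splitting off one variable repeatedly writes a monomial as a product with a factor of any
  prescribed smaller degree; this is why Veronese subrings are generated in one degree.\<close>

lemma exp_split:
  assumes "e \<le> exp_deg m"
  obtains a b where "m = a + b" "exp_deg a = e"
proof -
  have "\<exists>a b. m = a + b \<and> exp_deg a = e"
    using assms
  proof (induction e)
    case 0
    show ?case by (rule exI[of _ 0], rule exI[of _ m]) simp
  next
    case (Suc e)
    then obtain a b where ab: "m = a + b" "exp_deg a = e" by auto
    with Suc.prems have "b \<noteq> 0" by (auto simp: exp_deg_add)
    then obtain i where i: "Poly_Mapping.lookup b i \<noteq> 0"
      by (metis lookup_zero poly_mapping_eqI)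
    have "b = Poly_Mapping.single i 1 + (b - Poly_Mapping.single i 1)"
      using i by (intro poly_mapping_eqI) (auto simp: lookup_add lookup_minus lookup_single when_def)
    then have "m = (a + Poly_Mapping.single i 1) + (b - Poly_Mapping.single i 1)"
      using ab by (metis add.assoc)
    then show ?case using ab by (metis exp_deg_add exp_deg_single Suc_eq_plus1)
  qed
  then show ?thesis using that by blast
qed

subsection \<open>Counting monomials\<close>

definition Exps :: "nat set \<Rightarrow> (nat \<Rightarrow> bool) \<Rightarrow> (nat \<Rightarrow>\<^sub>0 nat) set" where
  "Exps J P = {m. Poly_Mapping.keys m \<subseteq> J \<and> P (exp_deg m)}"

lemma card_Exps_eq:
  assumes "finite J"
  shows "finite (Exps J (\<lambda>t. t = n))" "card (Exps J (\<lambda>t. t = n)) = (n + card J - 1) choose n"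
proof -
  let ?xs = "sorted_list_of_set J"
  have xs: "set ?xs = J" "distinct ?xs" "length ?xs = card J" using assms by auto
  define f where "f m = map (Poly_Mapping.lookup m) ?xs" for m :: "nat \<Rightarrow>\<^sub>0 nat"
  let ?L = "{l::nat list. length l = card J \<and> sum_list l = n}"
  have inj: "inj_on f (Exps J (\<lambda>t. t = n))"
  proof (rule inj_onI, rule poly_mapping_eqI)
    fix a b k assume "a \<in> Exps J (\<lambda>t. t = n)" "b \<in> Exps J (\<lambda>t. t = n)" "f a = f b"
    then show "Poly_Mapping.lookup a k = Poly_Mapping.lookup b k"
      using xs(1) by (cases "k \<in> J") (simp_all add: f_def Exps_def in_keys_iff subset_iff, metis not_gr_zero)
  qed
  have img: "f ` Exps J (\<lambda>t. t = n) = ?L"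
  proof
    show "f ` Exps J (\<lambda>t. t = n) \<subseteq> ?L"
      using xs assms
      by (auto simp: f_def Exps_def exp_deg_superset sum_list_distinct_conv_sum_set)
    show "?L \<subseteq> f ` Exps J (\<lambda>t. t = n)"
    proof
      fix l assume l: "l \<in> ?L"
      define g where "g k = (if k \<in> J then the (map_of (zip ?xs l) k) else 0)" for k
      have fin: "finite {k. g k \<noteq> 0}"
        by (rule finite_subset[OF _ assms]) (auto simp: g_def)
      define m where "m = Abs_poly_mapping g"
      have lm: "Poly_Mapping.lookup m = g" unfolding m_def using fin by simp
      have keys: "Poly_Mapping.keys m \<subseteq> J"
        by (auto simp: in_keys_iff lm g_def split: if_splits)
      have "f m = l"
        unfolding f_def lm
      proof (rule nth_equalityI)
        show "length (map g ?xs) = length l" using l xs by auto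
        fix i assume "i < length (map g ?xs)"
        then have i: "i < length ?xs" "i < length l" using l xs by auto
        then have "?xs ! i \<in> J" using xs nth_mem by blast
        then show "map g ?xs ! i = l ! i"
          using i map_of_zip_nth[of ?xs l i] l xs by (auto simp: g_def)
      qed
      moreover have "exp_deg m = n"
        using \<open>f m = l\<close> l xs exp_deg_superset[OF assms keys]
        by (metis (mono_tags, lifting) f_def mem_Collect_eq sum_list_distinct_conv_sum_set)
      ultimately show "l \<in> f ` Exps J (\<lambda>t. t = n)" using keys by (auto simp: Exps_def)
    qed
  qed
  have finL: "finite ?L"
  proof (rule finite_subset)
    show "?L \<subseteq> {l. set l \<subseteq> {..n} \<and> length l = card J}"
      using member_le_sum_list by force
    show "finite {l. set l \<subseteq> {..n} \<and> length l = card J}" by (rule finite_lists_length_eq) simp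
  qed
  show "finite (Exps J (\<lambda>t. t = n))" using finL img inj finite_image_iff by metis
  show "card (Exps J (\<lambda>t. t = n)) = (n + card J - 1) choose n"
    using card_image[OF inj] img card_length_sum_list by metis
qed

lemma card_Exps_Union:
  assumes "finite J" "finite T"
  shows "finite (Exps J (\<lambda>t. t \<in> T))"
    "card (Exps J (\<lambda>t. t \<in> T)) = (\<Sum>t\<in>T. (t + card J - 1) choose t)"
proof -
  have *: "Exps J (\<lambda>t. t \<in> T) = (\<Union>t\<in>T. Exps J (\<lambda>u. u = t))" by (auto simp: Exps_def)
  show "finite (Exps J (\<lambda>t. t \<in> T))" unfolding * using assms card_Exps_eq(1) by blast
  show "card (Exps J (\<lambda>t. t \<in> T)) = (\<Sum>t\<in>T. (t + card J - 1) choose t)"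
    unfolding * using assms card_Exps_eq
    by (subst card_UN_disjoint) (auto simp: Exps_def)
qed

lemma card_Exps_le:
  assumes "finite J"
  shows "finite (Exps J (\<lambda>t. t \<le> n))" "card (Exps J (\<lambda>t. t \<le> n)) = (n + card J) choose n"
proof -
  show "finite (Exps J (\<lambda>t. t \<le> n))" using card_Exps_Union(1)[OF assms, of "{..n}"] by simp
  have c: "card (Exps J (\<lambda>t. t \<le> n)) = (\<Sum>t\<le>n. (t + card J - 1) choose t)"
    using card_Exps_Union(2)[OF assms, of "{..n}"] by simp
  show "card (Exps J (\<lambda>t. t \<le> n)) = (n + card J) choose n"
  proof (cases "card J")
    case 0
    have "(\<Sum>t\<le>n. (t - 1) choose t) = (\<Sum>t\<in>{0}. (t - 1) choose t)"
      by (rule sum.mono_neutral_right) auto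
    then show ?thesis using c 0 by simp
  next
    case (Suc r)
    then show ?thesis using c sum_choose_lower[of r n] by (simp add: add.commute)
  qed
qed

lemma choose_bounds:
  "real n ^ s \<le> fact s * real ((n + s) choose n)" "fact s * real ((n + s) choose n) \<le> real (n + s) ^ s"
proof -
  have eq: "fact s * real ((n + s) choose n) = (\<Prod>i<s. real (n + s - i))"
  proof -
    have "(n + s) choose n = (n + s) choose s" using binomial_symmetric[of n "n + s"] by simp
    then show ?thesis
      using binomial_gbinomial[of "n+s" s, where ?'a = real]
      by (simp add: gbinomial_prod_rev atLeast0LessThan of_nat_diff)
  qed
  show "real n ^ s \<le> fact s * real ((n + s) choose n)"
    unfolding eq using prod_mono[of "{..<s}" "\<lambda>_. real n" "\<lambda>i. real (n + s - i)"] by simp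
  show "fact s * real ((n + s) choose n) \<le> real (n + s) ^ s"
    unfolding eq using prod_mono[of "{..<s}" "\<lambda>i. real (n + s - i)" "\<lambda>_. real (n + s)"] by simp
qed

subsection \<open>Linearly independent families\<close>

text \<open>Independence is stated for families indexed by an arbitrary finite set, since products of
  two families come with a product index set and need not be injective beforehand.\<close>

definition ind_fam :: "'i set \<Rightarrow> ('i \<Rightarrow> ('k::field) mpol) \<Rightarrow> bool" where
  "ind_fam I f \<longleftrightarrow> (\<forall>c. (\<Sum>i\<in>I. smul (c i) (f i)) = 0 \<longrightarrow> (\<forall>i\<in>I. c i = 0))"

lemma ind_fam_inj:
  assumes "finite I" "ind_fam I f"
  shows "inj_on f I"
proof (rule inj_onI, rule ccontr)
  fix i j assume ij: "i \<in> I" "j \<in> I" "f i = f j" "i \<noteq> j"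
  define c :: "_ \<Rightarrow> 'b" where "c x = (if x = i then 1 else if x = j then -1 else 0)" for x
  have "(\<Sum>x\<in>I. smul (c x) (f x)) = (\<Sum>x\<in>{i,j}. smul (c x) (f x))"
    by (rule sum.mono_neutral_right) (use assms ij in \<open>auto simp: c_def\<close>)
  also have "\<dots> = 0" using ij by (simp add: c_def)
  finally have "c i = 0" using assms ij unfolding ind_fam_def by blast
  then show False by (simp add: c_def)
qed

lemma ind_fam_independent:
  assumes "finite I" "ind_fam I f"
  shows "mp.independent (f ` I)"
proof (rule mp.independent_if_scalars_zero)
  show "finite (f ` I)" using assms by simp
  fix c x assume "(\<Sum>x\<in>f ` I. smul (c x) x) = 0" "x \<in> f ` I"
  then show "c x = 0"
    using assms by (auto simp: sum.reindex[OF ind_fam_inj[OF assms]] ind_fam_def)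
qed

lemma ind_fam_card_le:
  assumes "finite I" "ind_fam I f" "f ` I \<subseteq> mp.span T" "finite T"
  shows "card I \<le> card T"
  using mp.independent_span_bound[OF assms(4) ind_fam_independent[OF assms(1,2)] assms(3)]
    card_image[OF ind_fam_inj[OF assms(1,2)]] by simp

lemma independent_ind_fam:
  fixes Bs :: "('k::field) mpol set"
  assumes "finite Bs" "mp.independent Bs"
  shows "ind_fam Bs (\<lambda>u. u)"
  using assms mp.independentD[OF assms(2,1)] unfolding ind_fam_def by blast

lemma finite_basis:
  assumes "finite T" "V \<subseteq> mp.span T"
  obtains Bs where "finite Bs" "Bs \<subseteq> V" "mp.independent Bs" "V \<subseteq> mp.span Bs" "card Bs = mp.dim V"
  using mp.basis_exists[of V] mp.independent_span_bound[OF assms(1)] assms(2) by (metis subset_trans)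

subsection \<open>Discarding monomials\<close>

lift_definition restr :: "'a set \<Rightarrow> ('a \<Rightarrow>\<^sub>0 'b::zero) \<Rightarrow> 'a \<Rightarrow>\<^sub>0 'b" is
  "\<lambda>S f k. f k when k \<in> S"
  by (auto intro: finite_subset)

lemma lookup_restr: "Poly_Mapping.lookup (restr S p) k = (Poly_Mapping.lookup p k when k \<in> S)"
  by transfer simp

lemma keys_restr: "Poly_Mapping.keys (restr S p) = Poly_Mapping.keys p \<inter> S"
  by (auto simp: in_keys_iff lookup_restr)

lemma restr_zero [simp]: "restr S 0 = 0"
  by (rule poly_mapping_eqI) (simp add: lookup_restr)

lemma restr_add: "restr S (p + q) = restr S p + restr S (q :: ('k::field) mpol)"
  by (rule poly_mapping_eqI) (simp add: lookup_restr lookup_add when_add_distrib)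

lemma restr_smul: "restr S (smul c p) = smul c (restr S p)"
  by (rule poly_mapping_eqI) (simp add: lookup_restr lookup_smul mult_when)

lemma restr_sum: "restr S (\<Sum>i\<in>I. f i) = (\<Sum>i\<in>I. restr S (f i :: ('k::field) mpol))"
  by (rule poly_mapping_eqI) (simp add: lookup_restr lookup_sum when_def)

lemma restr_id: "Poly_Mapping.keys p \<subseteq> S \<Longrightarrow> restr S p = p"
  by (rule poly_mapping_eqI) (auto simp: lookup_restr when_def in_keys_iff)

lemma restr_empty: "Poly_Mapping.keys p \<inter> S = {} \<Longrightarrow> restr S p = 0"
  by (rule poly_mapping_eqI) (auto simp: lookup_restr when_def in_keys_iff)

lemma mpol_induct [case_names zero add]:
  fixes p :: "('k::field) mpol"
  assumes "P 0" "\<And>c m q. P q \<Longrightarrow> P (smul c (monom m) + q)"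
  shows "P p"
proof -
  have "P (\<Sum>m\<in>F. smul (Poly_Mapping.lookup p m) (monom m))" if "finite F" for F
    using that by (induction F) (use assms in auto)
  then show ?thesis using monom_expansion[of p] finite_keys[of p] by metis
qed

text \<open>Setting variables to zero keeps exactly the monomials in the other variables.  This is
  multiplicative because a product of monomials survives iff both factors do.\<close>

lemma restr_mult:
  fixes p q :: "('k::field) mpol"
  assumes "\<And>a b. a + b \<in> S \<longleftrightarrow> a \<in> S \<and> b \<in> S"
  shows "restr S (p * q) = restr S p * restr S q"
proof -
  have r: "restr S (monom a) = (if a \<in> S then monom a else 0 :: 'k mpol)" for a
    by (simp add: restr_id restr_empty)
  have mm: "restr S (monom a * monom b) = restr S (monom a) * restr S (monom b :: 'k mpol)" for a b
    using assms[of a b] by (simp add: mult_single r)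
  have m: "restr S (monom a * q) = restr S (monom a) * restr S q" for a
    by (induction q rule: mpol_induct)
      (simp_all add: distrib_left restr_add smul_mult_right restr_smul mm)
  show ?thesis
    by (induction p rule: mpol_induct)
      (simp_all add: distrib_right restr_add smul_mult_left restr_smul m)
qed

section \<open>Subrings of a domain as carriers\<close>

definition subring_set :: "('a::comm_ring_1) set \<Rightarrow> bool" where
  "subring_set H \<longleftrightarrow> 1 \<in> H \<and> (\<forall>a\<in>H. \<forall>b\<in>H. a + b \<in> H \<and> a * b \<in> H) \<and> (\<forall>a\<in>H. - a \<in> H)"

definition ring_on :: "('a::comm_ring_1) set \<Rightarrow> 'a ring" where
  "ring_on H = ring_of_type_algebra \<lparr> carrier := H \<rparr>"

lemma ring_on_simps [simp]:
  "carrier (ring_on H) = H" "x \<otimes>\<^bsub>ring_on H\<^esub> y = x * y" "x \<oplus>\<^bsub>ring_on H\<^esub> y = x + y"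
  "\<one>\<^bsub>ring_on H\<^esub> = 1" "\<zero>\<^bsub>ring_on H\<^esub> = 0"
  by (simp_all add: ring_on_def ring_of_type_algebra_def)

lemma subring_set_zero: "subring_set H \<Longrightarrow> 0 \<in> H"
  unfolding subring_set_def by (metis add.right_inverse)

lemma cring_ring_on:
  assumes "subring_set H"
  shows "cring (ring_on H)"
proof (rule cringI)
  show "abelian_group (ring_on H)"
    by (rule abelian_groupI)
      (use assms subring_set_zero[OF assms] in
        \<open>auto simp: subring_set_def algebra_simps intro: bexI[of _ "- _"]\<close>)
  show "comm_monoid (ring_on H)"
    by (rule comm_monoidI) (use assms in \<open>auto simp: subring_set_def algebra_simps\<close>)
qed (auto simp: algebra_simps)

lemma a_inv_ring_on:
  assumes "subring_set H" "x \<in> H"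
  shows "\<ominus>\<^bsub>ring_on H\<^esub> x = - x"
proof -
  interpret cring "ring_on H" by (rule cring_ring_on[OF assms(1)])
  have "- x \<in> H" using assms by (auto simp: subring_set_def)
  then show ?thesis using minus_equality[of "- x" x] assms by simp
qed

lemma nat_pow_ring_on: "x [^]\<^bsub>ring_on H\<^esub> (n::nat) = x ^ n"
  by (induction n) (auto simp: nat_pow_def algebra_simps)

lemma ideal_ring_on:
  assumes "subring_set H"
  shows "ideal J (ring_on H) \<longleftrightarrow> J \<subseteq> H \<and> 0 \<in> J \<and> (\<forall>a\<in>J. \<forall>b\<in>J. a + b \<in> J)
    \<and> (\<forall>x\<in>H. \<forall>a\<in>J. x * a \<in> J)" (is "?l \<longleftrightarrow> ?r")
proof
  interpret cring "ring_on H" by (rule cring_ring_on[OF assms])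
  show "?r" if ?l
  proof -
    interpret ideal J "ring_on H" by (rule that)
    show ?r
      using a_subset zero_closed a_closed I_l_closed by auto
  qed
  show ?l if r: ?r
  proof (rule idealI[OF ring_axioms])
    have "- 1 \<in> H" using assms by (simp add: subring_set_def)
    then have neg: "- a \<in> J" if "a \<in> J" for a
      using r that by (metis mult_minus1)
    show "subgroup J (add_monoid (ring_on H))"
      by (rule add.subgroupI)
        (use r neg a_inv_ring_on[OF assms] in \<open>auto simp: a_inv_def[symmetric] subset_iff\<close>)
  qed (use r in \<open>simp_all, metis mult.commute\<close>)
qed

lemma primeideal_ring_on:
  assumes "subring_set H"
  shows "primeideal J (ring_on H) \<longleftrightarrow> ideal J (ring_on H) \<and> J \<noteq> H \<and>
    (\<forall>a\<in>H. \<forall>b\<in>H. a * b \<in> J \<longrightarrow> a \<in> J \<or> b \<in> J)"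
  using cring_ring_on[OF assms]
  by (auto simp: primeideal_def primeideal_axioms_def)

section \<open>The polynomial ring and its graded subalgebras\<close>

lemma mpol_ring_on: "mpol_ring s = ring_on {p. Poly_Mapping.keys p \<subseteq> Exps {..<s} (\<lambda>_. True)}"
  by (auto simp: mpol_ring_def ring_on_def Exps_def intro!: arg_cong[where f = "\<lambda>c. _ \<lparr> carrier := c \<rparr>"])

lemma keys_mult_subset:
  assumes "Poly_Mapping.keys p \<subseteq> S" "Poly_Mapping.keys q \<subseteq> T" "\<And>a b. a \<in> S \<Longrightarrow> b \<in> T \<Longrightarrow> a + b \<in> U"
  shows "Poly_Mapping.keys (p * q) \<subseteq> U"
  using keys_mult[of p q] assms by fastforce

lemma subring_set_mpol: "subring_set {p :: ('k::field) mpol. Poly_Mapping.keys p \<subseteq> Exps J (\<lambda>_. True)}"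
proof -
  have "Poly_Mapping.keys (p * q) \<subseteq> Exps J (\<lambda>_. True)"
    if "Poly_Mapping.keys p \<subseteq> Exps J (\<lambda>_. True)" "Poly_Mapping.keys q \<subseteq> Exps J (\<lambda>_. True)" for p q :: "'k mpol"
    by (rule keys_mult_subset[OF that]) (auto simp: Exps_def keys_add_nat)
  moreover have "Poly_Mapping.keys (p + q) \<subseteq> Exps J (\<lambda>_. True)"
    if "Poly_Mapping.keys p \<subseteq> Exps J (\<lambda>_. True)" "Poly_Mapping.keys q \<subseteq> Exps J (\<lambda>_. True)" for p q :: "'k mpol"
    using keys_add[of p q] that by blast
  moreover have "Poly_Mapping.keys (- p) = Poly_Mapping.keys p" for p :: "'k mpol"
    by (auto simp: in_keys_iff)
  ultimately show ?thesis by (auto simp: subring_set_def Exps_def)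
qed

lemma homog_part_iff: "p \<in> homog_part s d \<longleftrightarrow> Poly_Mapping.keys p \<subseteq> Exps {..<s} (\<lambda>t. t = d)"
  unfolding homog_part_def mpol_ring_on by (auto simp: Exps_def)

lemma homog_part_span: "homog_part s d = mp.span (monom ` Exps {..<s} (\<lambda>t. t = d))"
  using span_monom_iff homog_part_iff by blast

lemma max_homog_ideal_eq:
  "max_homog_ideal s = {p :: ('k::field) mpol. Poly_Mapping.keys p \<subseteq> Exps {..<s} (\<lambda>_. True)
     \<and> Poly_Mapping.lookup p 0 = 0}" (is "_ = ?M")
proof -
  let ?H = "{p :: 'k mpol. Poly_Mapping.keys p \<subseteq> Exps {..<s} (\<lambda>_. True)}"
  note sr = subring_set_mpol[of "{..<s}", where 'k = 'k]
  interpret R: cring "ring_on ?H" by (rule cring_ring_on[OF sr])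
  have var: "mvar ` {..<s} \<subseteq> ?H"
    by (auto simp: mvar_def Exps_def)
  have M: "ideal ?M (ring_on ?H)"
    unfolding ideal_ring_on[OF sr]
  proof (intro conjI ballI)
    fix x a assume xa: "x \<in> ?H" "a \<in> ?M"
    have "Poly_Mapping.keys (x * a) \<subseteq> UNIV - {0}"
      by (rule keys_mult_subset[of x UNIV a "UNIV - {0}"])
        (use xa in \<open>auto simp: in_keys_iff exp_deg_eq_zero[symmetric] exp_deg_add dest: arg_cong[of _ 0 exp_deg]\<close>)
    then have "Poly_Mapping.lookup (x * a) 0 = 0" by (auto simp: in_keys_iff)
    then show "x * a \<in> ?M" using sr xa by (auto simp: subring_set_def)
  qed (use sr subring_set_zero[OF sr] in \<open>auto simp: subring_set_def lookup_add\<close>)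
  show ?thesis
    unfolding max_homog_ideal_def mpol_ring_on
  proof
    have "Poly_Mapping.single i (Suc 0) \<noteq> 0" for i :: nat
      using exp_deg_single[of i "Suc 0"] exp_deg_zero by (metis zero_neq_one One_nat_def)
    then show "Idl\<^bsub>ring_on ?H\<^esub> (mvar ` {..<s}) \<subseteq> ?M"
      by (intro R.genideal_minimal[OF M]) (auto simp: mvar_def Exps_def lookup_single when_def)
    let ?I = "Idl\<^bsub>ring_on ?H\<^esub> (mvar ` {..<s}) :: 'k mpol set"
    have I: "ideal ?I (ring_on ?H)" by (rule R.genideal_ideal) (use var in simp)
    have sub: "mvar ` {..<s} \<subseteq> ?I" by (rule R.genideal_self) (use var in simp)
    note I' = I[unfolded ideal_ring_on[OF sr]]
    show "?M \<subseteq> ?I"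
    proof
      fix p :: "'k mpol" assume p: "p \<in> ?M"
      have "smul c (monom m) \<in> ?I" if m: "m \<in> Poly_Mapping.keys p" for m c
      proof -
        have "m \<noteq> 0" using p m by (auto simp: in_keys_iff)
        then have "exp_deg m \<ge> 1" using exp_deg_eq_zero[of m] by simp
        then obtain a b where ab: "m = a + b" "exp_deg a = 1" by (rule exp_split)
        then have "a \<noteq> 0" by auto
        then obtain i where i: "i \<in> Poly_Mapping.keys a"
          by (metis lookup_zero poly_mapping_eqI in_keys_iff)
        have mi: "i \<in> Poly_Mapping.keys m" using i ab by (simp add: keys_add_nat)
        let ?u = "Poly_Mapping.single i (1::nat)"
        have mu: "m = (m - ?u) + ?u"
          using mi by (intro poly_mapping_eqI) (auto simp: lookup_add lookup_minus lookup_single when_def in_keys_iff)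
        have mH: "Poly_Mapping.keys m \<subseteq> {..<s}" using p m by (auto simp: Exps_def)
        then have "i < s" using mi by auto
        then have v: "mvar i \<in> ?I" using sub by blast
        have "Poly_Mapping.keys (m - ?u) \<subseteq> {..<s}"
          using mH by (fastforce simp: in_keys_iff lookup_minus subset_iff)
        then have "Poly_Mapping.single (m - ?u) c \<in> ?H" by (auto simp: Exps_def)
        then have "Poly_Mapping.single (m - ?u) c * mvar i \<in> ?I" using I' v by blast
        then show ?thesis using mu by (simp add: mvar_def mult_single smul_monom)
      qed
      moreover have "(\<Sum>m\<in>F. f m) \<in> ?I" if "\<And>m. m \<in> F \<Longrightarrow> f m \<in> ?I" "finite F" for f and F :: "(nat \<Rightarrow>\<^sub>0 nat) set"
        using that(2,1) by (induction F) (use I' in auto)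
      ultimately show "p \<in> ?I" by (subst monom_expansion) auto
    qed
  qed
qed

subsection \<open>Degree pieces\<close>

text \<open>\<open>power_span V j\<close> is the space spanned by the \<open>j\<close>-fold products of elements of \<open>V\<close>, that is,
  the component of degree \<open>j\<close> of the regraded algebra \<open>k[V]\<close>; \<open>pieces V T\<close> collects the components
  with degrees in \<open>T\<close>.  Initial segments \<open>T\<close> give the degree filtration and final segments
  \<open>T\<close> give the powers of the maximal homogeneous ideal.\<close>

primrec power_span :: "('k::field) mpol set \<Rightarrow> nat \<Rightarrow> 'k mpol set" where
  "power_span V 0 = mp.span {1}"
| "power_span V (Suc j) = mp.span {a * v | a v. a \<in> power_span V j \<and> v \<in> V}"

definition pieces :: "('k::field) mpol set \<Rightarrow> nat set \<Rightarrow> 'k mpol set" where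
  "pieces V T = mp.span (\<Union>j\<in>T. power_span V j)"

lemma span_power_span: "mp.span (power_span V j) = power_span V j"
  by (cases j) (auto simp: mp.span_span)

lemma power_span_mult: "a \<in> power_span V i \<Longrightarrow> b \<in> power_span V j \<Longrightarrow> a * b \<in> power_span V (i + j)"
proof (induction j arbitrary: b)
  case 0
  have "a * b \<in> mp.span (power_span V i)"
    by (rule span_mult_closed[of a "power_span V i" b "{1}"])
      (use 0 in \<open>auto intro: mp.span_base\<close>)
  then show ?case by (simp add: span_power_span)
next
  case (Suc j)
  have "a * b \<in> mp.span (power_span V (i + Suc j))"
  proof (rule span_mult_closed[of a "{a}" b])
    show "b \<in> mp.span {a * v |a v. a \<in> power_span V j \<and> v \<in> V}" using Suc.prems by simp
    fix x y assume "x \<in> {a}" "y \<in> {a * v |a v. a \<in> power_span V j \<and> v \<in> V}"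
    then obtain a' v where y: "x = a" "y = a' * v" "a' \<in> power_span V j" "v \<in> V" by blast
    then have "(a * a') * v \<in> power_span V (Suc (i + j))"
      using Suc.IH[OF Suc.prems(1)] by (auto intro!: mp.span_base)
    then show "x * y \<in> mp.span (power_span V (i + Suc j))"
      using y by (simp add: mult.assoc mp.span_span)
  qed (auto intro: mp.span_base)
  then show ?case by (simp only: span_power_span)
qed

lemma one_in_power_span: "1 \<in> power_span V 0"
  by (auto intro: mp.span_base)

lemma power_span_1: "V \<subseteq> power_span V 1"
  using one_in_power_span[of V] by (force intro!: mp.span_base simp del: power_span.simps(1))

lemma subspace_pieces: "mp.subspace (pieces V T)"
  by (simp add: pieces_def)

lemma pieces_add: "a \<in> pieces V T \<Longrightarrow> b \<in> pieces V T \<Longrightarrow> a + b \<in> pieces V T"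
  and pieces_smul: "a \<in> pieces V T \<Longrightarrow> smul c a \<in> pieces V T"
  and pieces_zero: "0 \<in> pieces V T"
  by (simp_all add: pieces_def mp.span_add mp.span_scale mp.span_zero)

lemma power_span_pieces: "j \<in> T \<Longrightarrow> power_span V j \<subseteq> pieces V T"
  by (auto simp: pieces_def intro: mp.span_base)

lemma pieces_mono: "S \<subseteq> T \<Longrightarrow> pieces V S \<subseteq> pieces V T"
  unfolding pieces_def by (rule mp.span_mono) blast

lemma pieces_mult:
  assumes "a \<in> pieces V S" "b \<in> pieces V T" "\<And>i j. i \<in> S \<Longrightarrow> j \<in> T \<Longrightarrow> i + j \<in> U"
  shows "a * b \<in> pieces V U"
  using assms(1,2) unfolding pieces_def
  by (rule span_mult_closed) (auto intro!: mp.span_base dest: assms(3) power_span_mult)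

lemma pieces_Un: "a \<in> pieces V (S \<union> T) \<Longrightarrow> \<exists>b\<in>pieces V S. \<exists>c\<in>pieces V T. a = b + c"
  unfolding pieces_def by (auto simp: mp.span_Un)

lemma pieces_single: "pieces V {j} = power_span V j"
  by (simp add: pieces_def span_power_span)

lemma pieces_bounded:
  assumes "a \<in> pieces V UNIV"
  obtains n where "a \<in> pieces V {..n}"
proof -
  have "\<exists>n. a \<in> pieces V {..n}"
    using assms unfolding pieces_def[of V UNIV]
  proof (induction rule: mp.span_induct_alt)
    case base
    show ?case using pieces_zero by blast
  next
    case (step c x y)
    then obtain n j where n: "y \<in> pieces V {..n}" "x \<in> power_span V j" by auto
    have "y \<in> pieces V {..max n j}" "x \<in> pieces V {..max n j}"
      using n pieces_mono[of "{..n}" "{..max n j}" V] power_span_pieces[of j "{..max n j}" V] by auto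
    then show ?case by (auto intro: pieces_add pieces_smul)
  qed
  then show ?thesis using that by blast
qed

lemma pieces_uniformly_bounded:
  assumes "finite F" "F \<subseteq> pieces V UNIV"
  obtains n where "F \<subseteq> pieces V {..n}"
proof -
  have "\<exists>n. F \<subseteq> pieces V {..n}"
    using assms
  proof (induction F)
    case (insert x F)
    then obtain n m where nm: "F \<subseteq> pieces V {..n}" "x \<in> pieces V {..m}"
      using pieces_bounded by (metis insert_subset)
    have "insert x F \<subseteq> pieces V {..max n m}"
      using nm pieces_mono[of "{..n}" "{..max n m}" V] pieces_mono[of "{..m}" "{..max n m}" V] by auto
    then show ?case by blast
  qed auto
  then show ?thesis using that by blast
qed

lemma power_span_homog:
  assumes "V \<subseteq> homog_part s d"
  shows "power_span V j \<subseteq> homog_part s (j * d)"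
proof (induction j)
  case 0
  have "Exps {..<s} (\<lambda>t. t = 0) = {0}" by (auto simp: Exps_def exp_deg_eq_zero)
  then show ?case by (simp add: homog_part_span)
next
  case (Suc j)
  have "a * v \<in> homog_part s (Suc j * d)" if "a \<in> power_span V j" "v \<in> V" for a v
    unfolding homog_part_iff
  proof (rule keys_mult_subset)
    show "Poly_Mapping.keys a \<subseteq> Exps {..<s} (\<lambda>t. t = j * d)"
      using that Suc homog_part_iff by blast
    show "Poly_Mapping.keys v \<subseteq> Exps {..<s} (\<lambda>t. t = d)"
      using that assms homog_part_iff by blast
  qed (auto simp: Exps_def exp_deg_add keys_add_nat)
  then have "{a * v |a v. a \<in> power_span V j \<and> v \<in> V} \<subseteq> homog_part s (Suc j * d)" by blast
  moreover have "mp.subspace (homog_part s (Suc j * d))" by (simp add: homog_part_span)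
  ultimately show ?case unfolding power_span.simps by (rule mp.span_minimal)
qed

lemma pieces_keys:
  assumes "V \<subseteq> homog_part s d"
  shows "pieces V T \<subseteq> mp.span (monom ` Exps {..<s} (\<lambda>t. t \<in> (\<lambda>j. j * d) ` T))"
  unfolding pieces_def
proof (rule mp.span_minimal)
  have "Exps {..<s} (\<lambda>t. t = j * d) \<subseteq> Exps {..<s} (\<lambda>t. t \<in> (\<lambda>j. j * d) ` T)" if "j \<in> T" for j
    using that by (auto simp: Exps_def)
  then have "homog_part s (j * d) \<subseteq> mp.span (monom ` Exps {..<s} (\<lambda>t. t \<in> (\<lambda>j. j * d) ` T))"
    if "j \<in> T" for j
    unfolding homog_part_span using that by (intro mp.span_mono image_mono) auto
  then show "\<Union> (power_span V ` T) \<subseteq> mp.span (monom ` Exps {..<s} (\<lambda>t. t \<in> (\<lambda>j. j * d) ` T))"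
    using power_span_homog[OF assms] by blast
qed simp

lemma pieces_disjoint:
  assumes "V \<subseteq> homog_part s d" "d \<ge> 1" "S \<inter> T = {}" "a \<in> pieces V S" "a \<in> pieces V T"
  shows "a = 0"
proof -
  have "Poly_Mapping.keys a \<subseteq> Exps {..<s} (\<lambda>t. t \<in> (\<lambda>j. j * d) ` S) \<inter> Exps {..<s} (\<lambda>t. t \<in> (\<lambda>j. j * d) ` T)"
    using pieces_keys[OF assms(1)] assms(4,5) span_monom_iff by blast
  also have "\<dots> = {}" using assms(2,3) by (auto simp: Exps_def)
  finally show ?thesis by (auto intro!: poly_mapping_eqI simp: in_keys_iff)
qed

lemma subring_set_pieces: "subring_set (pieces V UNIV)"
proof -
  have "- a = smul (- 1) a" for a :: "'a mpol" by simp
  then show ?thesis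
    unfolding subring_set_def
    using one_in_power_span power_span_pieces[of 0 UNIV V]
    by (auto intro: pieces_add pieces_smul pieces_mult simp del: mp.scale_minus_left)
qed

lemma subalg_ring_pieces:
  assumes "V \<subseteq> homog_part s d"
  shows "subalg_ring s V = ring_on (pieces V UNIV)"
proof -
  let ?H = "{p :: 'a mpol. Poly_Mapping.keys p \<subseteq> Exps {..<s} (\<lambda>_. True)}"
  note sr = subring_set_mpol[of "{..<s}", where 'k = 'a]
  interpret R: cring "ring_on ?H" by (rule cring_ring_on[OF sr])
  let ?G = "generate_ring (ring_on ?H) (constants \<union> V)"
  have incl: "constants \<union> V \<subseteq> carrier (ring_on ?H)"
  proof -
    have "Exps {..<s} (\<lambda>t. t = d) \<subseteq> Exps {..<s} (\<lambda>_. True)" by (auto simp: Exps_def)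
    moreover have "constants \<subseteq> ?H" by (auto simp: constants_def Exps_def split: if_splits)
    moreover have "p \<in> ?H" if "p \<in> V" for p
      using subsetD[OF assms that] calculation(1) homog_part_iff[of p s d] by simp
    ultimately show ?thesis by auto
  qed
  have G: "subring_set ?G"
    unfolding subring_set_def
  proof (intro conjI ballI)
    show "1 \<in> ?G" using generate_ring.one[of "ring_on ?H"] by simp
    fix a b assume ab: "a \<in> ?G" "b \<in> ?G"
    show "a + b \<in> ?G" "a * b \<in> ?G"
      using generate_ring.eng_add[OF ab] generate_ring.eng_mult[OF ab] by simp_all
  next
    fix a assume a: "a \<in> ?G"
    then have "a \<in> ?H" using R.generate_ring_in_carrier[OF incl] by simp
    then show "- a \<in> ?G" using generate_ring.a_inv[OF a] a_inv_ring_on[OF sr] by simp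
  qed
  have smulG: "smul c a \<in> ?G" if "a \<in> ?G" for c a
  proof -
    have "Poly_Mapping.single 0 c \<in> ?G" by (rule generate_ring.incl) (simp add: constants_def)
    then show ?thesis using G that unfolding smul_def subring_set_def by blast
  qed
  have subG: "mp.subspace ?G"
    using G subring_set_zero[OF G] smulG by (auto simp: mp.subspace_def subring_set_def)
  have "power_span V j \<subseteq> ?G" for j
  proof (induction j)
    case 0
    show ?case
      unfolding power_span.simps by (rule mp.span_minimal[OF _ subG]) (use G in \<open>simp add: subring_set_def\<close>)
  next
    case (Suc j)
    have "V \<subseteq> ?G" by (auto intro: generate_ring.incl)
    then show ?case
      unfolding power_span.simps
      by (intro mp.span_minimal[OF _ subG]) (use Suc G in \<open>auto simp: subring_set_def\<close>)
  qed
  then have 1: "pieces V UNIV \<subseteq> ?G"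
    unfolding pieces_def using subG by (intro mp.span_minimal) auto
  have "a \<in> pieces V UNIV" if "a \<in> ?G" for a
    using that
  proof (induction rule: generate_ring.induct)
    case (incl h)
    have "Poly_Mapping.single 0 c \<in> pieces V UNIV" for c
    proof -
      have "Poly_Mapping.single 0 c = smul c 1" by (simp add: smul_def)
      then show ?thesis
        using one_in_power_span[of V] power_span_pieces[of 0 UNIV V] by (auto intro: pieces_smul)
    qed
    then show ?case using incl power_span_1[of V] power_span_pieces[of 1 UNIV V]
      by (auto simp: constants_def)
  next
    case (a_inv h)
    have "h \<in> ?H" using R.generate_ring_in_carrier[OF incl a_inv(1)] by simp
    then show ?case using a_inv subring_set_pieces[of V] a_inv_ring_on[OF sr]
      by (auto simp: subring_set_def)
  qed (use subring_set_pieces[of V] in \<open>auto simp: subring_set_def\<close>)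
  then have "?G = pieces V UNIV" using 1 by blast
  then show ?thesis
    unfolding subalg_ring_def mpol_ring_on by (simp add: ring_on_def)
qed

lemma irrelevant_ideal_eq:
  assumes "V \<subseteq> homog_part s d" "d \<ge> 1"
  shows "pieces V UNIV \<inter> max_homog_ideal s = pieces V {1..}"
proof -
  have 0: "Poly_Mapping.lookup a 0 = 0" if "a \<in> pieces V {1..}" for a
  proof -
    have "Poly_Mapping.keys a \<subseteq> Exps {..<s} (\<lambda>t. t \<in> (\<lambda>j. j * d) ` {1..})"
      using pieces_keys[OF assms(1)] that span_monom_iff by blast
    then have "0 \<notin> Poly_Mapping.keys a" using assms(2) by (auto simp: Exps_def)
    then show ?thesis by (simp add: in_keys_iff)
  qed
  have "a \<in> pieces V {1..}" if a: "a \<in> pieces V UNIV" "Poly_Mapping.lookup a 0 = 0" for a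
  proof -
    have "UNIV = {0::nat} \<union> {1..}" by auto
    then obtain b c where bc: "a = b + c" "b \<in> pieces V {0}" "c \<in> pieces V {1..}"
      using pieces_Un a(1) by metis
    then obtain x where "b = smul x 1"
      by (auto simp: pieces_single mp.span_singleton)
    moreover have "Poly_Mapping.lookup b 0 = 0" using bc a 0 by (simp add: lookup_add)
    ultimately have "b = 0" by (simp add: lookup_smul)
    then show ?thesis using bc by simp
  qed
  moreover have "Poly_Mapping.keys p \<subseteq> Exps {..<s} (\<lambda>_. True)" if "p \<in> pieces V UNIV" for p
  proof -
    have "Poly_Mapping.keys p \<subseteq> Exps {..<s} (\<lambda>t. t \<in> range (\<lambda>j. j * d))"
      using pieces_keys[OF assms(1)] that span_monom_iff by blast
    then show ?thesis by (auto simp: Exps_def)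
  qed
  moreover have "pieces V {1..} \<subseteq> pieces V UNIV" by (rule pieces_mono) simp
  ultimately show ?thesis
    using 0 unfolding max_homog_ideal_eq by blast
qed

text \<open>The algebra is generated in degree one, so each component of degree \<open>j > n\<close> is spanned by
  products of an element of degree \<open>j - 1\<close> and one of degree \<open>1\<close>.\<close>

lemma irrelevant_ideal_power:
  "pieces V {1..} [^]\<^bsub>ideals_set (ring_on (pieces V UNIV))\<^esub> (n::nat) = pieces V {n..}"
proof (induction n)
  case 0
  show ?case by (simp add: nat_pow_def ideals_set_def atLeast_0)
next
  case (Suc n)
  let ?R = "ring_on (pieces V UNIV)"
  let ?P = "ideal_prod ?R (pieces V {n..}) (pieces V {1..})"
  have "pieces V {1..} [^]\<^bsub>ideals_set ?R\<^esub> Suc n = ?P"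
    using Suc by (simp add: nat_pow_def ideals_set_def)
  also have "?P = pieces V {Suc n..}"
  proof
    show "?P \<subseteq> pieces V {Suc n..}"
    proof
      fix a assume "a \<in> ?P"
      then show "a \<in> pieces V {Suc n..}"
        by (induction rule: ideal_prod.induct) (auto intro: pieces_add pieces_mult)
    qed
    have scale: "smul c a \<in> ?P" if "a \<in> ?P" for a c
      using that
    proof (induction rule: ideal_prod.induct)
      case (prod i j)
      then show ?case
        using ideal_prod.prod[of "smul c i" "pieces V {n..}" j "pieces V {1..}" ?R]
        by (simp add: smul_mult_left pieces_smul)
    next
      case (sum a b)
      then show ?case using ideal_prod.sum[OF sum(3,4)] by (simp add: mp.scale_right_distrib)
    qed
    have zero: "0 \<in> ?P"
      using ideal_prod.prod[of 0 "pieces V {n..}" 0 "pieces V {1..}" ?R] pieces_zero[of V] by simp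
    have sub: "mp.subspace ?P"
      using zero scale ideal_prod.sum[of _ ?R] by (auto simp: mp.subspace_def)
    have "power_span V j \<subseteq> ?P" if "j \<ge> Suc n" for j
    proof -
      obtain i where j: "j = Suc i" "i \<ge> n" using \<open>j \<ge> Suc n\<close> by (cases j) auto
      have "a * v \<in> ?P" if "a \<in> power_span V i" "v \<in> V" for a v
      proof -
        have "a \<in> pieces V {n..}" "v \<in> pieces V {1..}"
          using that j power_span_pieces[of i "{n..}" V] power_span_pieces[of 1 "{1..}" V] power_span_1[of V]
          by auto
        then show ?thesis using ideal_prod.prod[of a _ v _ ?R] by simp
      qed
      then show ?thesis unfolding j power_span.simps using sub by (intro mp.span_minimal) auto
    qed
    then show "pieces V {Suc n..} \<subseteq> ?P"
      unfolding pieces_def[of V "{Suc n..}"] using sub by (intro mp.span_minimal) auto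
  qed
  finally show ?case .
qed

section \<open>Lengths of the quotients by powers of the irrelevant ideal\<close>

definition strict_chain :: "('a set \<Rightarrow> bool) \<Rightarrow> nat \<Rightarrow> (nat \<Rightarrow> 'a set) \<Rightarrow> bool" where
  "strict_chain P n c \<longleftrightarrow> (\<forall>i\<le>n. P (c i)) \<and> (\<forall>i<n. c i \<subset> c (Suc i))"

lemma chain_sup_eqI:
  assumes "strict_chain P n c" "\<And>m c. strict_chain P m c \<Longrightarrow> m \<le> n"
  shows "chain_sup P = enat n"
  unfolding chain_sup_def strict_chain_def[symmetric]
  by (rule antisym, rule Sup_least) (use assms in \<open>auto intro: Sup_upper\<close>)

lemma strict_chain_mono:
  assumes "strict_chain P n c" "i \<le> j" "j \<le> n"
  shows "c i \<subseteq> c j"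
  using assms(2,3)
proof (induction j rule: dec_induct)
  case (step j)
  then have "c j \<subset> c (Suc j)" using assms(1) by (auto simp: strict_chain_def)
  then show ?case using step by auto
qed simp

lemma strict_chain_map:
  assumes "strict_chain P n c" "\<And>J. P J \<Longrightarrow> Q (f J)" "\<And>J J'. P J \<Longrightarrow> P J' \<Longrightarrow> J \<subset> J' \<Longrightarrow> f J \<subset> f J'"
  shows "strict_chain Q n (f \<circ> c)"
  using assms by (auto simp: strict_chain_def)

lemma (in ring) ring_length_Quot:
  assumes "ideal I R"
  shows "ring_length (R Quot I) = chain_sup (\<lambda>J. ideal J R \<and> I \<subseteq> J)"
proof -
  let ?f = "\<lambda>J. (+>) I ` J" and ?P = "\<lambda>J. ideal J R \<and> I \<subseteq> J" and ?Q = "\<lambda>J. ideal J (R Quot I)"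
  have bij: "bij_betw ?f {J. ?P J} {J. ?Q J}" by (rule quot_ideal_correspondence[OF assms])
  have union: "\<Union> (?f J) = J" if "?P J" for J
    using ideal_incl_iff[OF assms, of J] that by blast
  have inj: "?P J \<Longrightarrow> ?P J' \<Longrightarrow> ?f J = ?f J' \<Longrightarrow> J = J'" for J J' using union by metis
  have "(\<exists>c. strict_chain ?P n c) \<longleftrightarrow> (\<exists>c. strict_chain ?Q n c)" for n
  proof
    assume "\<exists>c. strict_chain ?P n c"
    then obtain c where "strict_chain ?P n c" ..
    then have "strict_chain ?Q n (?f \<circ> c)"
    proof (rule strict_chain_map)
      show "?Q (?f J)" if "?P J" for J using bij that by (auto simp: bij_betw_def)
      show "?f J \<subset> ?f J'" if "?P J" "?P J'" "J \<subset> J'" for J J'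
        using inj[OF that(1,2)] that(3) by (metis image_mono psubset_eq)
    qed
    then show "\<exists>c. strict_chain ?Q n c" by blast
  next
    assume "\<exists>c. strict_chain ?Q n c"
    then obtain c where "strict_chain ?Q n c" ..
    moreover have Q: "\<exists>J'. ?P J' \<and> J = ?f J' \<and> \<Union> J = J'" if "?Q J" for J
    proof -
      have "J \<in> ?f ` {J. ?P J}" using bij that by (simp add: bij_betw_def)
      then show ?thesis using union by blast
    qed
    ultimately have "strict_chain ?P n (Union \<circ> c)"
    proof (rule_tac strict_chain_map[where f = Union])
      show "?P (\<Union> J)" if "?Q J" for J using Q[OF that] by auto
      show "\<Union> J \<subset> \<Union> J'" if "?Q J" "?Q J'" "J \<subset> J'" for J J'
        using Q[OF that(1)] Q[OF that(2)] that(3) by (metis Union_mono psubset_eq)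
    qed
    then show "\<exists>c. strict_chain ?P n c" by blast
  qed
  then show ?thesis
    unfolding ring_length_def chain_sup_def strict_chain_def by presburger
qed

lemma subspace_ideal:
  assumes "ideal J (ring_on (pieces V UNIV))"
  shows "mp.subspace J"
proof -
  note i = assms[unfolded ideal_ring_on[OF subring_set_pieces]]
  have "smul c 1 \<in> pieces V UNIV" for c
    using one_in_power_span power_span_pieces[of 0 UNIV V] by (intro pieces_smul) auto
  moreover have "smul c a = smul c 1 * a" for c a by (simp add: smul_def)
  ultimately have "smul c a \<in> J" if "a \<in> J" for c a using i that by metis
  then show ?thesis using i by (auto simp: mp.subspace_def)
qed

lemma pieces_finite_span:
  assumes "V \<subseteq> homog_part s d" "finite T"
  obtains F where "finite F" "pieces V T \<subseteq> mp.span F"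
  using pieces_keys[OF assms(1), of T] card_Exps_Union(1)[of "{..<s}" "(\<lambda>j. j * d) ` T"] assms(2)
  by (metis finite_imageI finite_lessThan)

lemma ideal_pieces: "ideal (pieces V {n..}) (ring_on (pieces V UNIV))"
  unfolding ideal_ring_on[OF subring_set_pieces]
  using pieces_mono[of "{n..}" UNIV V] by (auto intro: pieces_add pieces_zero pieces_mult)

lemma pieces_split:
  assumes "a \<in> pieces V UNIV" "S \<union> T = UNIV"
  obtains b c where "a = b + c" "b \<in> pieces V S" "c \<in> pieces V T"
  using pieces_Un[of a V S T] assms by auto

lemma pieces_split_unit:
  assumes "a \<in> pieces V UNIV"
  obtains c g where "a = smul c 1 + g" "g \<in> pieces V {1..}"
proof -
  have "{0} \<union> {1..} = (UNIV :: nat set)" by auto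
  then obtain b g where bg: "a = b + g" "b \<in> pieces V {0}" "g \<in> pieces V {1..}"
    using pieces_split[OF assms] by blast
  then obtain c where "b = smul c 1" by (auto simp: pieces_single mp.span_singleton)
  then show ?thesis using that bg by blast
qed

text \<open>Picking one new element in each step of a chain of ideals above \<open>m\<^sup>n\<close>, reduced to degrees
  below \<open>n\<close>, gives linearly independent elements.\<close>

lemma ideal_chain_length_le:
  fixes V :: "('k::field) mpol set"
  assumes V: "V \<subseteq> homog_part s d"
    and c: "strict_chain (\<lambda>J. ideal J (ring_on (pieces V UNIV)) \<and> pieces V {n..} \<subseteq> J) l c"
  shows "l \<le> mp.dim (pieces V {..<n})"
proof -
  have id: "ideal (c i) (ring_on (pieces V UNIV))" "pieces V {n..} \<subseteq> c i" if "i \<le> l" for i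
    using c that by (auto simp: strict_chain_def)
  have sub: "mp.subspace (c i)" if "i \<le> l" for i using subspace_ideal id that by blast
  have "\<exists>y. y \<in> pieces V {..<n} \<and> y \<in> c (Suc i) \<and> y \<notin> c i" if i: "i < l" for i
  proof -
    obtain x where x: "x \<in> c (Suc i)" "x \<notin> c i" using c i unfolding strict_chain_def by blast
    then have "x \<in> pieces V UNIV"
      using id(1)[of "Suc i"] i by (auto simp: ideal_ring_on[OF subring_set_pieces])
    moreover have "{..<n} \<union> {n..} = UNIV" by auto
    ultimately obtain y g where yg: "x = y + g" "y \<in> pieces V {..<n}" "g \<in> pieces V {n..}"
      by (rule pieces_split)
    have g: "g \<in> c i" "g \<in> c (Suc i)" using yg(3) id(2)[of i] id(2)[of "Suc i"] i by auto
    have "y = x - g" using yg by simp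
    then have "y \<in> c (Suc i)" using x g sub[of "Suc i"] i by (simp add: mp.subspace_diff)
    moreover have "y \<notin> c i" using x g yg sub[of i] i mp.subspace_add by (metis less_imp_le_nat)
    ultimately show ?thesis using yg by blast
  qed
  then obtain y where y: "\<And>i. i < l \<Longrightarrow> y i \<in> pieces V {..<n} \<and> y i \<in> c (Suc i) \<and> y i \<notin> c i"
    by metis
  have "ind_fam {..<l} y"
    unfolding ind_fam_def
  proof (intro allI impI, rule ccontr)
    fix k :: "nat \<Rightarrow> 'k"
    assume sum: "(\<Sum>i<l. smul (k i) (y i)) = 0" and "\<not> (\<forall>i\<in>{..<l}. k i = 0)"
    then have ne: "{i. i < l \<and> k i \<noteq> 0} \<noteq> {}" by auto
    define m where "m = Max {i. i < l \<and> k i \<noteq> 0}"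
    have m: "m < l" "k m \<noteq> 0" using Max_in[OF _ ne] by (auto simp: m_def)
    have m': "k i = 0" if "i < l" "m < i" for i
      using Max_ge[of "{i. i < l \<and> k i \<noteq> 0}" i] that by (fastforce simp: m_def)
    have "(\<Sum>i<l. smul (k i) (y i)) = (\<Sum>i\<in>{..<Suc m}. smul (k i) (y i))"
      by (rule sum.mono_neutral_right) (use m m' in auto)
    then have eq: "smul (k m) (y m) = - (\<Sum>i<m. smul (k i) (y i))"
      using sum by (simp add: eq_neg_iff_add_eq_0 add.commute)
    have "y i \<in> c m" if "i < m" for i
      using y[of i] strict_chain_mono[OF c, of "Suc i" m] that m by auto
    then have "smul (k m) (y m) \<in> c m"
      unfolding eq using sub[of m] m by (auto intro!: mp.subspace_neg mp.subspace_sum mp.subspace_scale)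
    then have "smul (inverse (k m)) (smul (k m) (y m)) \<in> c m"
      by (rule mp.subspace_scale[OF sub[OF less_imp_le[OF m(1)]]])
    then show False using y[of m] m by simp
  qed
  moreover obtain F where F: "finite F" "pieces V {..<n} \<subseteq> mp.span F"
    using pieces_finite_span[OF V, of "{..<n}"] by auto
  obtain Bs where Bs: "finite Bs" "pieces V {..<n} \<subseteq> mp.span Bs" "card Bs = mp.dim (pieces V {..<n})"
    using finite_basis[OF F] by metis
  ultimately show ?thesis
    using ind_fam_card_le[of "{..<l}" y Bs] y by auto
qed

text \<open>Any ideal between \<open>m\<^sup>n\<close> and the whole algebra can be enlarged by a single vector: an element
  of highest possible order outside the ideal is multiplied into it by \<open>m\<close>.\<close>

lemma ideal_one_dim_extension:
  assumes J: "ideal J (ring_on (pieces V UNIV))" "pieces V {n..} \<subseteq> J" "J \<noteq> pieces V UNIV"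
  obtains y where "y \<in> pieces V UNIV" "y \<notin> J" "ideal (mp.span (insert y J)) (ring_on (pieces V UNIV))"
proof -
  note i = J(1)[unfolded ideal_ring_on[OF subring_set_pieces]]
  have subJ: "mp.subspace J" by (rule subspace_ideal[OF J(1)])
  define S where "S = {j. \<not> pieces V {j..} \<subseteq> J}"
  have "0 \<in> S" using i J(3) by (auto simp: S_def atLeast_0)
  moreover have "S \<subseteq> {..<n}"
    using J(2) pieces_mono[of "{_..}" "{n..}" V] by (force simp: S_def not_less)
  then have fin: "finite S" by (rule finite_subset) simp
  ultimately have "Max S \<in> S" by (intro Max_in) auto
  moreover have "Suc (Max S) \<notin> S" using Max_ge[OF fin, of "Suc (Max S)"] by auto
  ultimately obtain j y where y: "y \<in> pieces V {j..}" "y \<notin> J" "pieces V {Suc j..} \<subseteq> J"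
    by (auto simp: S_def)
  have yA: "y \<in> pieces V UNIV" using y(1) pieces_mono[of "{j..}" UNIV V] by auto
  have "ideal (mp.span (insert y J)) (ring_on (pieces V UNIV))"
    unfolding ideal_ring_on[OF subring_set_pieces]
  proof (intro conjI ballI)
    show "mp.span (insert y J) \<subseteq> pieces V UNIV"
      using yA i by (intro mp.span_minimal[OF _ subspace_pieces]) auto
    fix x a assume x: "x \<in> pieces V UNIV" and a: "a \<in> mp.span (insert y J)"
    then obtain k where "a - smul k y \<in> mp.span J" using mp.span_breakdown_eq by blast
    then have q: "a - smul k y \<in> J" using subJ by (simp add: mp.span_eq_iff[THEN iffD2])
    obtain e g where g: "x = smul e 1 + g" "g \<in> pieces V {1..}" by (rule pieces_split_unit[OF x])
    have "g * y \<in> J" using pieces_mult[OF g(2) y(1), of "{Suc j..}"] y(3) by auto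
    moreover have "x * (a - smul k y) \<in> J" using i x q by blast
    moreover have "x * a = smul (k * e) y + (x * (a - smul k y) + smul k (g * y))"
      unfolding g(1)
      by (simp add: algebra_simps smul_mult_right smul_mult_left mp.scale_right_distrib)
    ultimately show "x * a \<in> mp.span (insert y J)"
      by (auto intro!: mp.span_add mp.span_scale intro: mp.span_base)
  qed (auto intro: mp.span_add mp.span_zero)
  then show ?thesis using that yA y(2) by blast
qed

text \<open>One-dimensional enlargements, starting from \<open>m\<^sup>n\<close>, cannot reach the whole algebra before their
  number equals the dimension of the quotient.\<close>

lemma ideal_chain_exists:
  fixes V :: "('k::field) mpol set"
  assumes V: "V \<subseteq> homog_part s d" "d \<ge> 1" and "i \<le> mp.dim (pieces V {..<n})"
  shows "\<exists>c Y. strict_chain (\<lambda>J. ideal J (ring_on (pieces V UNIV)) \<and> pieces V {n..} \<subseteq> J) i c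
    \<and> finite Y \<and> card Y \<le> i \<and> Y \<subseteq> pieces V UNIV \<and> c i = mp.span (pieces V {n..} \<union> Y)"
  using assms(3)
proof (induction i)
  case 0
  have "pieces V {n..} = mp.span (pieces V {n..} \<union> {})"
    using subspace_pieces[of V "{n..}"] mp.span_eq_iff by (metis sup_bot_right)
  moreover have "strict_chain (\<lambda>J. ideal J (ring_on (pieces V UNIV)) \<and> pieces V {n..} \<subseteq> J) 0
      (\<lambda>_. pieces V {n..})"
    using ideal_pieces by (auto simp: strict_chain_def)
  ultimately show ?case
    by (intro exI[of _ "\<lambda>_. pieces V {n..}"] exI[of _ "{}"] conjI) (assumption | simp)+
next
  case (Suc i)
  then obtain c Y where c: "strict_chain (\<lambda>J. ideal J (ring_on (pieces V UNIV)) \<and> pieces V {n..} \<subseteq> J) i c"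
    and Y: "finite Y" "card Y \<le> i" "Y \<subseteq> pieces V UNIV" "c i = mp.span (pieces V {n..} \<union> Y)"
    by auto
  have split: "\<exists>z. z \<in> pieces V {..<n} \<and> a - z \<in> pieces V {n..}" if "a \<in> pieces V UNIV" for a
  proof -
    have "{..<n} \<union> {n..} = UNIV" by auto
    then obtain z g where "a = z + g" "z \<in> pieces V {..<n}" "g \<in> pieces V {n..}"
      using pieces_split[of a V "{..<n}" "{n..}"] \<open>a \<in> pieces V UNIV\<close> by blast
    then show ?thesis by (intro exI[of _ z]) simp
  qed
  have ne: "c i \<noteq> pieces V UNIV"
  proof
    assume eq: "c i = pieces V UNIV"
    obtain z where z: "\<And>y. y \<in> Y \<Longrightarrow> z y \<in> pieces V {..<n} \<and> y - z y \<in> pieces V {n..}"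
      using bchoice[of Y "\<lambda>y z. z \<in> pieces V {..<n} \<and> y - z \<in> pieces V {n..}"] split Y(3) by blast
    have red: "\<exists>u\<in>mp.span (z ` Y). t - u \<in> pieces V {n..}" if "t \<in> mp.span (pieces V {n..} \<union> Y)" for t
      using that
    proof (induction rule: mp.span_induct_alt)
      case base
      show ?case using mp.span_zero pieces_zero by force
    next
      case (step k x t)
      then obtain u where u: "u \<in> mp.span (z ` Y)" "t - u \<in> pieces V {n..}" by blast
      obtain v where v: "v \<in> mp.span (z ` Y)" "x - v \<in> pieces V {n..}"
      proof (cases "x \<in> Y")
        case True
        then show ?thesis using that[of "z x"] z by (auto intro: mp.span_base)
      next
        case False
        then show ?thesis using that[of 0] step(1) by (auto intro: mp.span_zero)
      qed
      have "smul k x + t - (smul k v + u) = smul k (x - v) + (t - u)"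
        by (simp add: mp.scale_right_diff_distrib)
      then show ?case using u v
        by (metis mp.span_add mp.span_scale pieces_add pieces_smul)
    qed
    have "pieces V {..<n} \<subseteq> mp.span (z ` Y)"
    proof
      fix a assume a: "a \<in> pieces V {..<n}"
      then have "a \<in> mp.span (pieces V {n..} \<union> Y)" using pieces_mono[of "{..<n}" UNIV V] eq Y(4) by auto
      then obtain u where u: "u \<in> mp.span (z ` Y)" "a - u \<in> pieces V {n..}" using red by blast
      have "mp.span (z ` Y) \<subseteq> pieces V {..<n}"
        using z by (intro mp.span_minimal[OF _ subspace_pieces]) auto
      then have "a - u \<in> pieces V {..<n}" using a u subspace_pieces mp.subspace_diff by blast
      then have "a - u = 0" using pieces_disjoint[OF V, of "{..<n}" "{n..}" "a - u"] u(2) by fastforce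
      then show "a \<in> mp.span (z ` Y)" using u by simp
    qed
    then have "mp.dim (pieces V {..<n}) \<le> card (z ` Y)" using Y(1) by (intro mp.dim_le_card) auto
    then show False using Suc.prems Y(1,2) card_image_le[of Y z] by linarith
  qed
  have ci: "ideal (c i) (ring_on (pieces V UNIV))" "pieces V {n..} \<subseteq> c i"
    using c by (auto simp: strict_chain_def)
  obtain y where y: "y \<in> pieces V UNIV" "y \<notin> c i" "ideal (mp.span (insert y (c i))) (ring_on (pieces V UNIV))"
    by (rule ideal_one_dim_extension[OF ci ne])
  define c' where "c' j = (if j \<le> i then c j else mp.span (insert y (c i)))" for j
  have "c i \<subset> mp.span (insert y (c i))" using y(2) by (auto intro: mp.span_base)
  moreover have "pieces V {n..} \<subseteq> mp.span (insert y (c i))" using ci(2) by (auto intro: mp.span_base)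
  ultimately have "strict_chain (\<lambda>J. ideal J (ring_on (pieces V UNIV)) \<and> pieces V {n..} \<subseteq> J) (Suc i) c'"
    using c y(3) by (auto simp: strict_chain_def c'_def less_Suc_eq)
  moreover have "c' (Suc i) = mp.span (pieces V {n..} \<union> insert y Y)"
  proof -
    have "mp.span (insert y (c i)) = mp.span (insert y (pieces V {n..} \<union> Y))"
      unfolding Y(4) mp.span_insert[of y] mp.span_span ..
    then show ?thesis by (simp add: c'_def)
  qed
  ultimately show ?case
    using Y y(1) by (intro exI[of _ c'] exI[of _ "insert y Y"]) (auto simp: card_insert_if)
qed

lemma ring_length_irrelevant_power:
  assumes "V \<subseteq> homog_part s d" "d \<ge> 1"
  shows "ring_length (ring_on (pieces V UNIV) Quot pieces V {n..}) = enat (mp.dim (pieces V {..<n}))"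
proof -
  let ?P = "\<lambda>J. ideal J (ring_on (pieces V UNIV)) \<and> pieces V {n..} \<subseteq> J"
  have R: "ring (ring_on (pieces V UNIV))"
    using cring_ring_on[OF subring_set_pieces] by (rule cring.axioms)
  obtain c where "strict_chain ?P (mp.dim (pieces V {..<n})) c"
    using ideal_chain_exists[OF assms order_refl] by blast
  then have "chain_sup ?P = enat (mp.dim (pieces V {..<n}))"
    by (rule chain_sup_eqI) (rule ideal_chain_length_le[OF assms(1)])
  then show ?thesis using ring.ring_length_Quot[OF R ideal_pieces] by simp
qed

section \<open>Krull dimension through growth\<close>

definition indep_mod :: "('k::field) mpol set \<Rightarrow> 'i set \<Rightarrow> ('i \<Rightarrow> 'k mpol) \<Rightarrow> bool" where
  "indep_mod P J f \<longleftrightarrow> (\<forall>c. (\<Sum>i\<in>J. smul (c i) (f i)) \<in> P \<longrightarrow> (\<forall>i\<in>J. c i = 0))"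

text \<open>\<open>large_mod V P n N\<close> expresses that the image of the \<open>n\<close>-th filtration step in \<open>A/P\<close> has
  dimension at least \<open>N\<close>.\<close>

definition large_mod :: "('k::field) mpol set \<Rightarrow> 'k mpol set \<Rightarrow> nat \<Rightarrow> nat \<Rightarrow> bool" where
  "large_mod V P n N \<longleftrightarrow> (\<exists>Bs. finite Bs \<and> Bs \<subseteq> pieces V {..n} \<and> card Bs = N \<and> indep_mod P Bs (\<lambda>u. u))"

lemma indep_mod_ind_fam: "0 \<in> P \<Longrightarrow> indep_mod P J f \<Longrightarrow> ind_fam J f"
  by (simp add: indep_mod_def ind_fam_def)

lemma large_modI:
  assumes "finite J" "f ` J \<subseteq> pieces V {..n}" "indep_mod P J f" "0 \<in> P" "N \<le> card J"
  shows "large_mod V P n N"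
proof -
  have inj: "inj_on f J" by (rule ind_fam_inj[OF assms(1) indep_mod_ind_fam[OF assms(4,3)]])
  obtain J' where J': "J' \<subseteq> J" "card J' = N" using obtain_subset_with_card_n[OF assms(5)] by metis
  have fin: "finite J'" using J' assms(1) finite_subset by blast
  have inj': "inj_on f J'" using inj J'(1) inj_on_subset by blast
  have "indep_mod P (f ` J') (\<lambda>u. u)"
    unfolding indep_mod_def
  proof (intro allI impI)
    fix c assume "(\<Sum>u\<in>f ` J'. smul (c u) u) \<in> P"
    then have "(\<Sum>i\<in>J'. smul (c (f i)) (f i)) \<in> P" by (simp add: sum.reindex[OF inj'])
    moreover have "(\<Sum>i\<in>J. smul (if i \<in> J' then c (f i) else 0) (f i)) = (\<Sum>i\<in>J'. smul (c (f i)) (f i))"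
      by (rule sum.mono_neutral_cong_right) (use assms(1) J'(1) in auto)
    ultimately have "(\<Sum>i\<in>J. smul (if i \<in> J' then c (f i) else 0) (f i)) \<in> P" by simp
    then have "\<forall>i\<in>J. (if i \<in> J' then c (f i) else 0) = 0"
      by (rule assms(3)[unfolded indep_mod_def, rule_format, THEN ballI])
    then have "c (f i) = 0" if "i \<in> J'" for i using that J'(1) by (auto dest: bspec[of J _ i])
    then show "\<forall>u\<in>f ` J'. c u = 0" by auto
  qed
  then show ?thesis
    unfolding large_mod_def using fin J' inj' assms(2)
    by (intro exI[of _ "f ` J'"]) (auto simp: card_image)
qed

text \<open>Passing from a prime \<open>P\<close> to a strictly larger ideal loses a full order of growth: for
  \<open>x \<in> Q - P\<close> and a space \<open>W\<close> that meets \<open>Q\<close> trivially, the sum \<open>W + W x + W x\<^sup>2 + \<dots>\<close> is direct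
  modulo \<open>P\<close>, since one can peel off the constant term modulo \<open>Q\<close> and cancel \<open>x\<close> modulo \<open>P\<close>.\<close>

lemma growth_step:
  fixes V :: "('k::field) mpol set"
  assumes P: "primeideal P (ring_on (pieces V UNIV))" and Q: "ideal Qd (ring_on (pieces V UNIV))"
    and sub: "P \<subset> Qd"
  obtains e where "\<And>n N. large_mod V Qd n N \<Longrightarrow> large_mod V P ((e + 1) * n) (n * N)"
proof -
  note i = Q[unfolded ideal_ring_on[OF subring_set_pieces]]
  have iP: "ideal P (ring_on (pieces V UNIV))"
    and Pprime: "\<And>a b. a \<in> pieces V UNIV \<Longrightarrow> b \<in> pieces V UNIV \<Longrightarrow> a * b \<in> P \<Longrightarrow> a \<in> P \<or> b \<in> P"
    using P by (auto simp: primeideal_ring_on[OF subring_set_pieces])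
  have zP: "0 \<in> P" using iP by (simp add: ideal_ring_on[OF subring_set_pieces])
  obtain x where x: "x \<in> Qd" "x \<notin> P" using sub by blast
  have xA: "x \<in> pieces V UNIV" using x i by blast
  obtain e where e: "x \<in> pieces V {..e}" using pieces_bounded[OF xA] .
  have pow: "x ^ j \<in> pieces V {..e * j}" for j
  proof (induction j)
    case 0
    show ?case using one_in_power_span[of V] power_span_pieces[of 0 "{..0}" V] by auto
  next
    case (Suc j)
    show ?case using pieces_mult[OF e Suc, of "{..e * Suc j}"] by auto
  qed
  have "large_mod V P ((e + 1) * n) (n * N)" if large: "large_mod V Qd n N" for n N
  proof -
    obtain Bs where Bs: "finite Bs" "Bs \<subseteq> pieces V {..n}" "card Bs = N" "indep_mod Qd Bs (\<lambda>u. u)"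
      using large by (auto simp: large_mod_def)
    have BsA: "Bs \<subseteq> pieces V UNIV" using Bs(2) pieces_mono[of "{..n}" UNIV V] by auto
    have wA: "(\<Sum>u\<in>Bs. smul (c u) u) \<in> pieces V UNIV" for c
      using BsA subspace_pieces by (intro mp.subspace_sum) (auto intro: pieces_smul)
    have peel: "\<forall>j<m. \<forall>u\<in>Bs. c u j = 0"
      if "(\<Sum>j<m. (\<Sum>u\<in>Bs. smul (c u j) u) * x ^ j) \<in> P" for m c
      using that
    proof (induction m arbitrary: c)
      case (Suc m)
      define w where "w j = (\<Sum>u\<in>Bs. smul (c u j) u)" for j
      have xpA: "x ^ j \<in> pieces V UNIV" for j using pow pieces_mono[of _ UNIV V] by blast
      have SA: "(\<Sum>j<m. w (Suc j) * x ^ j) \<in> pieces V UNIV"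
        using subspace_pieces xpA wA subring_set_pieces[of V] unfolding w_def
        by (intro mp.subspace_sum) (auto simp: subring_set_def)
      have eq: "(\<Sum>j<Suc m. w j * x ^ j) = w 0 + x * (\<Sum>j<m. w (Suc j) * x ^ j)"
        by (subst sum.lessThan_Suc_shift) (simp add: sum_distrib_left algebra_simps)
      have inP: "w 0 + x * (\<Sum>j<m. w (Suc j) * x ^ j) \<in> P"
        using Suc.prems eq by (simp add: w_def)
      have xS: "x * (\<Sum>j<m. w (Suc j) * x ^ j) \<in> Qd"
        using i x SA by (metis mult.commute)
      have "(w 0 + x * (\<Sum>j<m. w (Suc j) * x ^ j)) - x * (\<Sum>j<m. w (Suc j) * x ^ j) \<in> Qd"
        using inP sub xS subspace_ideal[OF Q] by (intro mp.subspace_diff) auto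
      then have "w 0 \<in> Qd" by simp
      then have c0: "\<forall>u\<in>Bs. c u 0 = 0"
        using Bs(4)[unfolded indep_mod_def, rule_format, of "\<lambda>u. c u 0"] unfolding w_def by blast
      then have "w 0 = 0" by (simp add: w_def)
      then have "x * (\<Sum>j<m. w (Suc j) * x ^ j) \<in> P" using inP by simp
      then have "(\<Sum>j<m. w (Suc j) * x ^ j) \<in> P" using Pprime[OF xA SA] x(2) by blast
      then have "\<forall>j<m. \<forall>u\<in>Bs. c u (Suc j) = 0"
        using Suc.IH[of "\<lambda>u j. c u (Suc j)"] by (simp add: w_def)
      then show ?case using c0 by (metis less_Suc_eq_0_disj)
    qed simp
    show ?thesis
    proof (rule large_modI)
      show "finite (Bs \<times> {..<n})" using Bs(1) by simp
      show "(\<lambda>(u, j). u * x ^ j) ` (Bs \<times> {..<n}) \<subseteq> pieces V {..(e + 1) * n}"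
      proof clarsimp
        fix u j assume uj: "u \<in> Bs" "j < n"
        have "a + b \<le> n + e * n" if "a \<le> n" "b \<le> e * j" for a b
          using that uj mult_le_mono2[of j n e] by linarith
        then show "u * x ^ j \<in> pieces V {..n + e * n}"
          using pieces_mult[OF subsetD[OF Bs(2) uj(1)] pow[of j], of "{..n + e * n}"] by auto
      qed
      show "indep_mod P (Bs \<times> {..<n}) (\<lambda>(u, j). u * x ^ j)"
        unfolding indep_mod_def
      proof (intro allI impI)
        fix c :: "'k mpol \<times> nat \<Rightarrow> 'k"
        assume "(\<Sum>i\<in>Bs \<times> {..<n}. smul (c i) ((\<lambda>(u, j). u * x ^ j) i)) \<in> P"
        also have "(\<Sum>i\<in>Bs \<times> {..<n}. smul (c i) ((\<lambda>(u, j). u * x ^ j) i))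
            = (\<Sum>u\<in>Bs. \<Sum>j<n. smul (c (u, j)) (u * x ^ j))"
          by (simp add: sum.cartesian_product case_prod_beta)
        also have "\<dots> = (\<Sum>j<n. (\<Sum>u\<in>Bs. smul (c (u, j)) u) * x ^ j)"
          by (subst sum.swap) (simp add: sum_distrib_right smul_mult_left)
        finally show "\<forall>i\<in>Bs \<times> {..<n}. c i = 0"
          using peel[where c = "\<lambda>u j. c (u, j)" and m = n] by auto
      qed
    qed (use zP Bs(3) in \<open>auto simp: card_cartesian_product\<close>)
  qed
  then show ?thesis using that by blast
qed

lemma chain_growth:
  fixes V :: "('k::field) mpol set"
  assumes c: "strict_chain (\<lambda>P. primeideal P (ring_on (pieces V UNIV))) m c"
  shows "\<exists>D\<ge>1. \<forall>n. large_mod V (c 0) (D * n) (n ^ m)"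
proof -
  have prime: "primeideal (c i) (ring_on (pieces V UNIV))" if "i \<le> m" for i
    using c that by (simp add: strict_chain_def)
  then have id: "ideal (c i) (ring_on (pieces V UNIV))" "c i \<noteq> pieces V UNIV" if "i \<le> m" for i
    using that by (auto simp: primeideal_ring_on[OF subring_set_pieces])
  have z: "0 \<in> c i" if "i \<le> m" for i
    using id(1)[OF that] by (simp add: ideal_ring_on[OF subring_set_pieces])
  have "\<exists>D\<ge>1. \<forall>n. large_mod V (c (m - i)) (D * n) (n ^ i)" if "i \<le> m" for i
    using that
  proof (induction i)
    case 0
    have "1 \<notin> c m"
    proof
      assume "1 \<in> c m"
      then have "x \<in> c m" if "x \<in> pieces V UNIV" for x
        using id(1)[of m] that by (force simp: ideal_ring_on[OF subring_set_pieces])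
      then show False using id[of m] by (auto simp: ideal_ring_on[OF subring_set_pieces])
    qed
    have "large_mod V (c m) n 1" for n
    proof (rule large_modI[where J = "{()}" and f = "\<lambda>_. 1"])
      show "(\<lambda>_. 1) ` {()} \<subseteq> pieces V {..n}"
        using one_in_power_span[of V] power_span_pieces[of 0 "{..n}" V] by auto
      show "indep_mod (c m) {()} (\<lambda>_. 1)"
        unfolding indep_mod_def
      proof (intro allI impI, rule ccontr)
        fix k :: "unit \<Rightarrow> 'k"
        assume k: "(\<Sum>i\<in>{()}. smul (k i) 1) \<in> c m" "\<not> (\<forall>i\<in>{()}. k i = 0)"
        then have "smul (k ()) 1 \<in> c m" "k () \<noteq> 0" by auto
        moreover from this(1) have "smul (inverse (k ())) (smul (k ()) 1) \<in> c m"
          by (rule mp.subspace_scale[OF subspace_ideal[OF id(1)[OF order_refl]]])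
        ultimately show False using \<open>1 \<notin> c m\<close> by simp
      qed
    qed (use z in auto)
    then show ?case by (intro exI[of _ 1]) simp
  next
    case (Suc i)
    then obtain D where D: "D \<ge> 1" "\<And>n. large_mod V (c (m - i)) (D * n) (n ^ i)" by auto
    have "m - i = Suc (m - Suc i)" using Suc.prems by auto
    then have "c (m - Suc i) \<subset> c (m - i)" using c Suc.prems by (auto simp: strict_chain_def)
    then obtain e where e: "\<And>n N. large_mod V (c (m - i)) n N \<Longrightarrow> large_mod V (c (m - Suc i)) ((e + 1) * n) (n * N)"
      using growth_step[OF prime id(1), of "m - Suc i" "m - i"] by auto
    have "large_mod V (c (m - Suc i)) ((e + 1) * D * n) (n ^ Suc i)" for n
    proof -
      have "large_mod V (c (m - Suc i)) ((e + 1) * (D * n)) (D * n * n ^ i)" by (rule e[OF D(2)])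
      then obtain Bs where Bs: "finite Bs" "Bs \<subseteq> pieces V {..(e + 1) * (D * n)}"
        "card Bs = D * n * n ^ i" "indep_mod (c (m - Suc i)) Bs (\<lambda>u. u)" by (auto simp: large_mod_def)
      show ?thesis
        by (rule large_modI[of Bs "\<lambda>u. u"]) (use Bs D(1) z in \<open>auto simp: mult.assoc algebra_simps\<close>)
    qed
    then show ?case using D(1) by (intro exI[of _ "(e + 1) * D"]) simp
  qed
  from this[of m] show ?thesis by simp
qed

lemma prime_chain_length_le:
  fixes V :: "('k::field) mpol set"
  assumes V: "V \<subseteq> homog_part s d"
    and c: "strict_chain (\<lambda>P. primeideal P (ring_on (pieces V UNIV))) m c"
  shows "m \<le> s"
proof (rule ccontr)
  assume "\<not> m \<le> s"
  obtain D where D: "D \<ge> 1" "\<And>n. large_mod V (c 0) (D * n) (n ^ m)" using chain_growth[OF c] by auto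
  have z: "0 \<in> c 0"
    using c by (auto simp: strict_chain_def primeideal_ring_on[OF subring_set_pieces]
        ideal_ring_on[OF subring_set_pieces])
  have bound: "real n ^ m \<le> real (D * n * d + s) ^ s" for n
  proof -
    obtain Bs where Bs: "finite Bs" "Bs \<subseteq> pieces V {..D * n}" "card Bs = n ^ m" "indep_mod (c 0) Bs (\<lambda>u. u)"
      using D(2)[of n] by (auto simp: large_mod_def)
    let ?E = "Exps {..<s} (\<lambda>t. t \<le> D * n * d)"
    have "Exps {..<s} (\<lambda>t. t \<in> (\<lambda>j. j * d) ` {..D * n}) \<subseteq> ?E"
      by (auto simp: Exps_def)
    then have "mp.span (monom ` Exps {..<s} (\<lambda>t. t \<in> (\<lambda>j. j * d) ` {..D * n})) \<subseteq> mp.span (monom ` ?E :: 'k mpol set)"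
      by (intro mp.span_mono image_mono)
    with pieces_keys[OF V] have "pieces V {..D * n} \<subseteq> mp.span (monom ` ?E)" by (rule subset_trans)
    then have "(\<lambda>u. u) ` Bs \<subseteq> mp.span (monom ` ?E)" using Bs(2) by auto
    then have "card Bs \<le> card (monom ` ?E :: 'k mpol set)"
      using ind_fam_card_le[OF Bs(1) indep_mod_ind_fam[OF z Bs(4)]] card_Exps_le(1)[of "{..<s}"] by auto
    also have "\<dots> = (D * n * d + s) choose (D * n * d)"
      using card_Exps_le(2)[of "{..<s}"] by (subst card_image) (auto intro: inj_on_subset[OF inj_monom])
    finally have "real (n ^ m) \<le> real ((D * n * d + s) choose (D * n * d))" using Bs(3) by simp
    also have "\<dots> \<le> fact s * real ((D * n * d + s) choose (D * n * d))"
      using fact_ge_1[of s, where ?'a = real] by (simp add: mult_le_cancel_right1)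
    also have "\<dots> \<le> real (D * n * d + s) ^ s" by (rule choose_bounds)
    finally show ?thesis by simp
  qed
  \<comment> \<open>For large \<open>n\<close> the power \<open>n\<^bsup>s+1\<^esup>\<close> exceeds the bound, which is at most \<open>E\<^sup>s n\<^sup>s\<close>.\<close>
  let ?E = "D * d + s"
  let ?n = "?E ^ s + 1"
  have "real ?n ^ Suc s \<le> real ?n ^ m"
    using \<open>\<not> m \<le> s\<close> by (intro power_increasing) auto
  also have "\<dots> \<le> real (D * ?n * d + s) ^ s" by (rule bound)
  also have "\<dots> \<le> real (?E * ?n) ^ s"
    by (intro power_mono of_nat_mono) (auto simp: algebra_simps)
  also have "\<dots> = real (?E ^ s) * real ?n ^ s" by (simp only: power_mult_distrib of_nat_mult of_nat_power)
  finally have "real ?n * real ?n ^ s \<le> real (?E ^ s) * real ?n ^ s" by (simp only: power_Suc)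
  moreover have "0 < real ?n ^ s" by (intro zero_less_power) (simp add: add_pos_nonneg del: of_nat_add)
  ultimately have "real ?n \<le> real (?E ^ s)" by (rule mult_right_le_imp_le)
  then show False by simp
qed

definition kill_below :: "nat \<Rightarrow> ('k::field) mpol \<Rightarrow> 'k mpol" where
  "kill_below i = restr {m. Poly_Mapping.keys m \<subseteq> {i..}}"

lemma kill_below_mult: "kill_below i (p * q) = kill_below i p * kill_below i q"
  unfolding kill_below_def by (rule restr_mult) (auto simp: keys_add_nat)

lemmas kill_below_linear =
  restr_add[of "{m. Poly_Mapping.keys m \<subseteq> {i..}}" for i, folded kill_below_def]
  restr_smul[of "{m. Poly_Mapping.keys m \<subseteq> {i..}}" for i, folded kill_below_def]
  restr_sum[of "{m. Poly_Mapping.keys m \<subseteq> {i..}}" for i, folded kill_below_def]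

lemma kill_below_monom: "kill_below i (monom m) = (if Poly_Mapping.keys m \<subseteq> {i..} then monom m else 0)"
  by (simp add: kill_below_def restr_id restr_empty)

lemma kill_below_kill_below: "i \<le> j \<Longrightarrow> kill_below j (kill_below i p) = kill_below j p"
  unfolding kill_below_def by (rule poly_mapping_eqI) (fastforce simp: lookup_restr when_def)

lemma kill_below_span: "p \<in> mp.span S \<Longrightarrow> kill_below i p \<in> mp.span (kill_below i ` S)"
proof (induction rule: mp.span_induct_alt)
  case base
  show ?case by (simp add: kill_below_def mp.span_zero)
next
  case (step c x y)
  then show ?case
    by (auto simp: kill_below_linear intro!: mp.span_add mp.span_scale intro: mp.span_base)
qed

text \<open>The contraction to \<open>k[V]\<close> of the prime ideal generated by the variables with index below
  \<open>i\<close>.\<close>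

definition coord_prime :: "('k::field) mpol set \<Rightarrow> nat \<Rightarrow> 'k mpol set" where
  "coord_prime V i = {p \<in> pieces V UNIV. kill_below i p = 0}"

lemma primeideal_coord_prime: "primeideal (coord_prime V i) (ring_on (pieces V UNIV))"
proof -
  have 1: "1 \<in> pieces V UNIV" "1 \<notin> coord_prime V i"
    using subring_set_pieces[of V] kill_below_monom[of i 0, where ?'a = 'a]
    by (auto simp: coord_prime_def subring_set_def)
  then show ?thesis
    unfolding primeideal_ring_on[OF subring_set_pieces] ideal_ring_on[OF subring_set_pieces]
    using pieces_zero[of V UNIV] subring_set_pieces[of V]
    by (auto simp: coord_prime_def kill_below_mult kill_below_linear subring_set_def)
      (auto simp: kill_below_def)
qed

text \<open>\<open>module_finite V s d t\<close> says that \<open>R\<close> is generated over \<open>k[V]\<close> by its elements of degree at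
  most \<open>t\<close>, homogeneous degree by degree.\<close>

definition module_finite :: "('k::field) mpol set \<Rightarrow> nat \<Rightarrow> nat \<Rightarrow> nat \<Rightarrow> bool" where
  "module_finite V s d t0 \<longleftrightarrow> (\<forall>t. \<exists>j. j * d \<le> t \<and> t - j * d \<le> t0 \<and>
     homog_part s t \<subseteq> mp.span {a * b | a b. a \<in> power_span V j \<and> b \<in> homog_part s (t - j * d)})"

text \<open>The chain of coordinate primes \<open>(x\<^sub>1, \<dots>, x\<^sub>i)\<close> contracts to a strictly increasing chain.
  If two neighbours had the same contraction, the image of \<open>A\<close> in \<open>k[x\<^sub>i\<^sub>+\<^sub>1, \<dots>, x\<^sub>s]\<close> would embed into
  \<open>k[x\<^sub>i\<^sub>+\<^sub>2, \<dots>, x\<^sub>s]\<close>; but \<open>k[x\<^sub>i\<^sub>+\<^sub>1, \<dots>, x\<^sub>s]\<close> is finite over that image, so its growth would be too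
  small by one order.\<close>

lemma coord_prime_strict:
  fixes V :: "('k::field) mpol set"
  assumes V: "V \<subseteq> homog_part s d" "d \<ge> 1" and fin: "module_finite V s d t0" and i: "i < s"
  shows "coord_prime V i \<noteq> coord_prime V (Suc i)"
proof
  assume eq: "coord_prime V i = coord_prime V (Suc i)"
  define K where "K = card (Exps {..<s} (\<lambda>t. t \<le> t0))"
  let ?E = "\<lambda>i n. Exps {i..<s} (\<lambda>t. t \<le> n * d)"
  have spanE: "kill_below i p \<in> mp.span (monom ` ?E i n)" if "p \<in> pieces V {..n}" for i n p
  proof -
    have "Poly_Mapping.keys p \<subseteq> Exps {..<s} (\<lambda>t. t \<in> (\<lambda>j. j * d) ` {..n})"
      using that pieces_keys[OF V(1)] span_monom_iff by blast
    then show ?thesis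
      unfolding span_monom_iff kill_below_def keys_restr by (fastforce simp: Exps_def)
  qed
  have step: "card (?E i n) \<le> K * card (?E (Suc i) n)" for n
  proof -
    have "kill_below i ` pieces V {..n} \<subseteq> mp.span (monom ` ?E i n)" using spanE by blast
    then obtain Bs where Bs: "finite Bs" "Bs \<subseteq> kill_below i ` pieces V {..n}" "mp.independent Bs"
      "kill_below i ` pieces V {..n} \<subseteq> mp.span Bs"
      using finite_basis[of "monom ` ?E i n"] card_Exps_le(1)[of "{i..<s}"] by (metis finite_atLeastLessThan finite_imageI)
    obtain g where g: "\<And>u. u \<in> Bs \<Longrightarrow> g u \<in> pieces V {..n} \<and> kill_below i (g u) = u"
      using bchoice[of Bs "\<lambda>u p. p \<in> pieces V {..n} \<and> kill_below i p = u"] Bs(2) by blast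
    have "ind_fam Bs (\<lambda>u. kill_below (Suc i) (g u))"
      unfolding ind_fam_def
    proof (intro allI impI)
      fix c assume "(\<Sum>u\<in>Bs. smul (c u) (kill_below (Suc i) (g u))) = 0"
      then have "kill_below (Suc i) (\<Sum>u\<in>Bs. smul (c u) (g u)) = 0"
        by (simp add: kill_below_linear)
      moreover have "(\<Sum>u\<in>Bs. smul (c u) (g u)) \<in> pieces V UNIV"
        using g pieces_mono[of "{..n}" UNIV V] subspace_pieces[of V UNIV]
        by (intro mp.subspace_sum) (auto intro: pieces_smul)
      ultimately have "(\<Sum>u\<in>Bs. smul (c u) (g u)) \<in> coord_prime V i"
        using eq by (auto simp: coord_prime_def)
      then have "(\<Sum>u\<in>Bs. smul (c u) (kill_below i (g u))) = 0"
        by (simp add: coord_prime_def kill_below_linear)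
      then have "(\<Sum>u\<in>Bs. smul (c u) u) = 0" using g by simp
      then show "\<forall>u\<in>Bs. c u = 0"
        using independent_ind_fam[OF Bs(1,3)] by (auto simp: ind_fam_def)
    qed
    moreover have "(\<lambda>u. kill_below (Suc i) (g u)) ` Bs \<subseteq> mp.span (monom ` ?E (Suc i) n)"
      using g spanE by blast
    moreover have "finite (monom ` ?E (Suc i) n :: 'k mpol set)"
      using card_Exps_le(1)[of "{Suc i..<s}"] by simp
    ultimately have "card Bs \<le> card (monom ` ?E (Suc i) n :: 'k mpol set)"
      by (rule ind_fam_card_le[OF Bs(1)])
    then have card_Bs: "card Bs \<le> card (?E (Suc i) n)"
      by (subst (asm) card_image) (auto intro: inj_on_subset[OF inj_monom])
    let ?M = "monom ` Exps {..<s} (\<lambda>t. t \<le> t0) :: 'k mpol set"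
    let ?T = "(\<lambda>(u, p). u * kill_below i p) ` (Bs \<times> ?M)"
    have finM: "finite ?M" using card_Exps_le(1)[of "{..<s}"] by auto
    have "monom m \<in> mp.span ?T" if m: "m \<in> ?E i n" for m
    proof -
      obtain j where j: "j * d \<le> exp_deg m" "exp_deg m - j * d \<le> t0" and
        sub: "homog_part s (exp_deg m) \<subseteq> mp.span {a * b | a b. a \<in> power_span V j \<and> b \<in> homog_part s (exp_deg m - j * d)}"
        using fin by (auto simp: module_finite_def)
      have "exp_deg m \<le> n * d" using m by (simp add: Exps_def)
      then have "j * d \<le> n * d" using j(1) by (rule order_trans[rotated])
      then have "j \<le> n" using V(2) mult_le_cancel2[of j d n] by linarith
      then have jn: "power_span V j \<subseteq> pieces V {..n}" by (intro power_span_pieces) simp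
      have "homog_part s (exp_deg m - j * d) \<subseteq> mp.span ?M"
        unfolding homog_part_span by (intro mp.span_mono image_mono) (use j(2) in \<open>auto simp: Exps_def\<close>)
      have "monom m \<in> homog_part s (exp_deg m)"
        using m by (auto simp: homog_part_iff Exps_def)
      then have "kill_below i (monom m) \<in> mp.span (kill_below i ` {a * b | a b. a \<in> power_span V j \<and> b \<in> homog_part s (exp_deg m - j * d)})"
        using sub by (intro kill_below_span) auto
      also have "\<dots> \<subseteq> mp.span ?T"
      proof (rule mp.span_minimal[OF _ mp.subspace_span], clarsimp simp: kill_below_mult)
        fix a b :: "'k mpol"
        assume a: "a \<in> power_span V j" and b: "b \<in> homog_part s (exp_deg m - j * d)"
        have "kill_below i a \<in> mp.span Bs" using a jn Bs(4) by auto
        moreover have "kill_below i b \<in> mp.span (kill_below i ` ?M)"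
          using b \<open>homog_part s (exp_deg m - j * d) \<subseteq> mp.span ?M\<close> by (intro kill_below_span) auto
        ultimately show "kill_below i a * kill_below i b \<in> mp.span ?T"
          by (rule span_mult_closed) (auto intro!: mp.span_base)
      qed
      finally have "kill_below i (monom m) \<in> mp.span ?T" .
      moreover have "Poly_Mapping.keys m \<subseteq> {i..}" using m by (fastforce simp: Exps_def)
      ultimately show ?thesis by (simp only: kill_below_monom if_True)
    qed
    then have "monom ` ?E i n \<subseteq> mp.span ?T" by auto
    moreover have "finite ?T" using finM Bs(1) by simp
    ultimately have "card (monom ` ?E i n :: 'k mpol set) \<le> card ?T"
      using mp.independent_span_bound[OF _ independent_monom] by blast
    also have "card ?T \<le> card (Bs \<times> ?M)" using finM Bs(1) by (intro card_image_le) auto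
    also have "\<dots> = card Bs * K"
      unfolding K_def by (simp add: card_cartesian_product card_image inj_on_subset[OF inj_monom])
    also have "\<dots> \<le> K * card (?E (Suc i) n)" using card_Bs by simp
    finally show ?thesis by (subst (asm) card_image) (auto intro: inj_on_subset[OF inj_monom])
  qed
  define u where "u = s - Suc i"
  have cards: "card (?E i n) = (n * d + Suc u) choose (Suc u)" "card (?E (Suc i) n) = (n * d + u) choose u" for n
  proof -
    have sym: "(N + r) choose N = (N + r) choose r" for N r :: nat
      using binomial_symmetric[of N "N + r"] by simp
    have "card {i..<s} = Suc u" "card {Suc i..<s} = u" using i by (auto simp: u_def)
    then show "card (?E i n) = (n * d + Suc u) choose (Suc u)" "card (?E (Suc i) n) = (n * d + u) choose u"
      by (metis card_Exps_le(2) finite_atLeastLessThan sym)+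
  qed
  have "n * d + Suc u \<le> K * Suc u" for n
  proof -
    have "(n * d + Suc u) * ((n * d + u) choose u) = Suc u * ((n * d + Suc u) choose Suc u)"
      using Suc_times_binomial_eq[of "n * d + u" u] by (simp add: algebra_simps)
    also have "\<dots> \<le> Suc u * (K * ((n * d + u) choose u))"
      using step[of n] unfolding cards by (intro mult_le_mono2)
    also have "\<dots> = (K * Suc u) * ((n * d + u) choose u)" by (simp only: ac_simps)
    finally show ?thesis by (subst (asm) mult_le_cancel2) auto
  qed
  \<comment> \<open>The left-hand side is unbounded in \<open>n\<close>, the right-hand side is constant.\<close>
  from this[of "K * Suc u"] have "K * Suc u * d + Suc u \<le> K * Suc u" .
  moreover have "K * Suc u * 1 \<le> K * Suc u * d" by (intro mult_le_mono2) (rule V(2))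
  ultimately show False by linarith
qed

lemma krull_dim_pieces:
  fixes V :: "('k::field) mpol set"
  assumes V: "V \<subseteq> homog_part s d" "d \<ge> 1" and fin: "module_finite V s d t0"
  shows "krull_dim (ring_on (pieces V UNIV)) = enat s"
  unfolding krull_dim_def
proof (rule chain_sup_eqI)
  have "coord_prime V i \<subseteq> coord_prime V (Suc i)" for i
  proof
    fix p assume p: "p \<in> coord_prime V i"
    have "kill_below (Suc i) p = kill_below (Suc i) (kill_below i p)"
      by (simp add: kill_below_kill_below)
    then show "p \<in> coord_prime V (Suc i)" using p by (simp add: coord_prime_def kill_below_def)
  qed
  then show "strict_chain (\<lambda>P. primeideal P (ring_on (pieces V UNIV))) s (coord_prime V)"
    using primeideal_coord_prime coord_prime_strict[OF V fin]
    by (auto simp: strict_chain_def psubset_eq)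
qed (rule prime_chain_length_le[OF V(1)])

section \<open>The degree of the extension of quotient fields\<close>

lemma ring_on_UNIV: "ring_of_type_algebra = ring_on UNIV"
  by (simp add: ring_on_def ring_of_type_algebra_def)

lemma field_ring_on_UNIV: "field (ring_on (UNIV :: ('a::Fields.field) set))"
  unfolding ring_on_UNIV[symmetric] by (rule field_from_type_algebra)

lemma combine_ring_on_UNIV:
  fixes us :: "('a::Fields.field) list"
  assumes "length ks = length us"
  shows "ring.combine (ring_on UNIV) ks us = (\<Sum>i<length us. ks ! i * us ! i)"
proof -
  interpret F: field "ring_on (UNIV :: 'a set)" by (rule field_ring_on_UNIV)
  show ?thesis
    using assms
  proof (induction ks us rule: list_induct2)
    case (Cons k ks u us)
    then show ?case by (simp add: sum.lessThan_Suc_shift del: sum.lessThan_Suc)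
  qed simp
qed

lemma quot_field_iff: "x \<in> quot_field S \<longleftrightarrow> (\<exists>a\<in>S. \<exists>b\<in>S. b \<noteq> 0 \<and> x = to_fract a / to_fract b)"
  by (auto simp: quot_field_def Fract_conv_to_fract)

lemma subfield_quot_field:
  assumes "subring_set (S :: ('a::idom) set)"
  shows "subfield (quot_field S) (ring_on UNIV)"
proof -
  interpret F: field "ring_on (UNIV :: 'a fract set)" by (rule field_ring_on_UNIV)
  have sr: "subring_set (UNIV :: 'a fract set)" by (simp add: subring_set_def)
  note cl = assms[unfolded subring_set_def]
  show ?thesis
  proof (rule F.subfieldI', rule F.subringI)
    show "\<one>\<^bsub>ring_on UNIV\<^esub> \<in> quot_field S"
      using cl unfolding quot_field_iff by (auto intro!: bexI[of _ 1])
    show "\<ominus>\<^bsub>ring_on UNIV\<^esub> h \<in> quot_field S" if "h \<in> quot_field S" for h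
    proof -
      obtain a b where "a \<in> S" "b \<in> S" "b \<noteq> 0" "h = to_fract a / to_fract b"
        using \<open>h \<in> quot_field S\<close>[unfolded quot_field_iff] by blast
      then show ?thesis using cl unfolding quot_field_iff a_inv_ring_on[OF sr UNIV_I]
        by (intro bexI[of _ "- a"] bexI[of _ b]) auto
    qed
    fix g h assume "g \<in> quot_field S" "h \<in> quot_field S"
    then obtain a b a' b' where ab: "a \<in> S" "b \<in> S" "b \<noteq> 0" "g = to_fract a / to_fract b"
      "a' \<in> S" "b' \<in> S" "b' \<noteq> 0" "h = to_fract a' / to_fract b'"
      unfolding quot_field_iff by blast
    show "g \<otimes>\<^bsub>ring_on UNIV\<^esub> h \<in> quot_field S"
      unfolding quot_field_iff
      by (intro bexI[of _ "a * a'"] bexI[of _ "b * b'"]) (use ab cl in auto)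
    show "g \<oplus>\<^bsub>ring_on UNIV\<^esub> h \<in> quot_field S"
      unfolding quot_field_iff
      by (intro bexI[of _ "a * b' + a' * b"] bexI[of _ "b * b'"]) (use ab cl in \<open>auto simp: field_simps\<close>)
  next
    fix k assume k: "k \<in> quot_field S - {\<zero>\<^bsub>ring_on UNIV\<^esub>}"
    then obtain a b where ab: "a \<in> S" "b \<in> S" "b \<noteq> 0" "k = to_fract a / to_fract b"
      by (auto simp: quot_field_iff)
    have "inv\<^bsub>ring_on UNIV\<^esub> k = inverse k"
      by (rule F.comm_inv_char) (use k in auto)
    moreover have "a \<noteq> 0" using k ab by auto
    ultimately show "inv\<^bsub>ring_on UNIV\<^esub> k \<in> quot_field S"
      unfolding quot_field_iff using ab by (intro bexI[of _ b] bexI[of _ a]) auto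
  qed simp
qed

lemma common_denominator:
  assumes "subring_set (S :: ('a::idom) set)" "finite T" "T \<subseteq> quot_field S"
  shows "\<exists>q\<in>S. q \<noteq> 0 \<and> (\<forall>k\<in>T. \<exists>a\<in>S. to_fract q * k = to_fract a)"
  using assms(2,3)
proof (induction T)
  case empty
  have "1 \<in> S" "(1::'a) \<noteq> 0" using assms(1) by (auto simp: subring_set_def)
  then show ?case by blast
next
  case (insert x T)
  note cl = assms(1)[unfolded subring_set_def]
  obtain q where q: "q \<in> S" "q \<noteq> 0" "\<forall>k\<in>T. \<exists>a\<in>S. to_fract q * k = to_fract a"
    using insert by auto
  obtain a b where ab: "a \<in> S" "b \<in> S" "b \<noteq> 0" "x = to_fract a / to_fract b"
    using insert.prems by (auto simp: quot_field_iff)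
  have "\<exists>c\<in>S. to_fract (b * q) * k = to_fract c" if "k \<in> insert x T" for k
  proof (cases "k = x")
    case True
    then show ?thesis using ab q cl by (intro bexI[of _ "a * q"]) auto
  next
    case False
    then have "k \<in> T" using that by simp
    with q(3) obtain c where c: "c \<in> S" "to_fract q * k = to_fract c" by (metis (no_types))
    have "to_fract (b * q) * k = to_fract (b * c)" using c(2) by (simp add: mult.assoc)
    then show ?thesis using ab(2) c(1) cl by (intro bexI[of _ "b * c"]) simp_all
  qed
  then show ?case using ab q cl by (intro bexI[of _ "b * q"]) auto
qed

lemma (in ring) spanning_sublist_base:
  assumes "subfield K R" "set Us \<subseteq> carrier R"
  shows "\<exists>Vs. set Vs \<subseteq> set Us \<and> independent K Vs \<and> Span K Vs = Span K Us"
  using assms(2)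
proof (induction Us)
  case (Cons u Us)
  then obtain Vs where Vs: "set Vs \<subseteq> set Us" "independent K Vs" "Span K Vs = Span K Us" by auto
  then have carr: "set Vs \<subseteq> carrier R" using Cons.prems by auto
  show ?case
  proof (cases "u \<in> Span K Vs")
    case True
    have "Span K (u # Us) = Span K (u # Vs)" using Vs(3) by simp
    also have "\<dots> = Span K Vs"
    proof
      show "Span K (u # Vs) \<subseteq> Span K Vs"
        by (rule subalgebra_Span_incl[OF assms(1) Span_is_subalgebra[OF assms(1) carr]])
          (use True Span_base_incl[OF assms(1) carr] in simp)
      show "Span K Vs \<subseteq> Span K (u # Vs)"
        using mono_Span[OF assms(1)] carr Cons.prems by auto
    qed
    finally show ?thesis using Vs by (intro exI[of _ Vs]) auto
  next
    case False
    then have "independent K (u # Vs)" using Vs(2) Cons.prems by (intro li_Cons) auto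
    moreover have "Span K (u # Vs) = Span K (u # Us)" using Vs(3) by simp
    ultimately show ?thesis using Vs(1) by (intro exI[of _ "u # Vs"]) auto
  qed
qed auto

text \<open>The span \<open>S\<close> of \<open>Cs\<close> over \<open>Quot A\<close> contains \<open>B\<close>.  Multiplication by a nonzero \<open>b \<in> B\<close> is an
  injective endomorphism of this finite-dimensional space, hence surjective, so \<open>S\<close> contains all
  fractions and equals \<open>Quot B\<close>; a basis can therefore be chosen inside \<open>Cs\<close>.  Clearing denominators
  puts a multiple of every element of \<open>Cs\<close> into the free module on the basis.\<close>

lemma domain_degree_basis:
  fixes A B :: "('a::idom) set"
  assumes A: "subring_set A" and B: "subring_set B" and sub: "A \<subseteq> B"
    and Cs: "finite Cs" "Cs \<subseteq> B" and gen: "\<And>b. b \<in> B \<Longrightarrow> \<exists>f. f ` Cs \<subseteq> A \<and> b = (\<Sum>c\<in>Cs. f c * c)"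
  obtains r v q where "domain_degree (ring_on A) (ring_on B) = enat r" "r > 0"
    "v ` {..<r} \<subseteq> Cs" "\<forall>f. f ` {..<r} \<subseteq> A \<longrightarrow> (\<Sum>i<r. f i * v i) = 0 \<longrightarrow> (\<forall>i<r. f i = 0)"
    "q \<in> A" "q \<noteq> 0" "\<forall>c\<in>Cs. \<exists>f. f ` {..<r} \<subseteq> A \<and> q * c = (\<Sum>i<r. f i * v i)"
proof -
  let ?K = "quot_field A" and ?L = "quot_field B"
  interpret F: field "ring_on (UNIV :: 'a fract set)" by (rule field_ring_on_UNIV)
  have K: "subfield ?K (ring_on UNIV)" by (rule subfield_quot_field[OF A])
  have AK: "to_fract a \<in> ?K" if "a \<in> A" for a
    using that A unfolding quot_field_iff by (intro bexI[of _ a] bexI[of _ 1]) (auto simp: subring_set_def)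
  obtain cs where cs: "set cs = Cs" using finite_list[OF Cs(1)] by blast
  let ?U = "map to_fract cs"
  obtain Vs where Vs: "set Vs \<subseteq> set ?U" "F.independent ?K Vs" "F.Span ?K Vs = F.Span ?K ?U"
    using F.spanning_sublist_base[OF K, of ?U] by auto
  define r where "r = length Vs"
  define S where "S = F.Span ?K Vs"
  have "\<forall>i<r. \<exists>c\<in>Cs. Vs ! i = to_fract c"
    using Vs(1) cs nth_mem[of _ Vs] unfolding r_def by fastforce
  then obtain v where v: "\<And>i. i < r \<Longrightarrow> v i \<in> Cs \<and> Vs ! i = to_fract (v i)" by metis
  have S_iff: "x \<in> S \<longleftrightarrow> (\<exists>k. k ` {..<r} \<subseteq> ?K \<and> x = (\<Sum>i<r. k i * to_fract (v i)))" for x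
  proof
    assume "x \<in> S"
    then obtain Ks where Ks: "set Ks \<subseteq> ?K" "length Ks = length Vs" "x = F.combine Ks Vs"
      using F.Span_mem_iff_length_version[OF K, of Vs x] unfolding S_def by auto
    then have "x = (\<Sum>i<r. Ks ! i * to_fract (v i))"
      using combine_ring_on_UNIV[OF Ks(2)] v by (simp add: r_def)
    moreover have "(\<lambda>i. Ks ! i) ` {..<r} \<subseteq> ?K" using Ks(1,2) by (auto simp: r_def)
    ultimately show "\<exists>k. k ` {..<r} \<subseteq> ?K \<and> x = (\<Sum>i<r. k i * to_fract (v i))" by blast
  next
    assume "\<exists>k. k ` {..<r} \<subseteq> ?K \<and> x = (\<Sum>i<r. k i * to_fract (v i))"
    then obtain k where k: "k ` {..<r} \<subseteq> ?K" "x = (\<Sum>i<r. k i * to_fract (v i))" by blast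
    then have "set (map k [0..<r]) \<subseteq> ?K" "x = F.combine (map k [0..<r]) Vs"
      using v by (auto simp: combine_ring_on_UNIV r_def)
    then show "x \<in> S"
      using F.Span_mem_iff_length_version[OF K, of Vs x] unfolding S_def
      by (auto simp: r_def intro!: exI[of _ "map k [0..<r]"])
  qed
  have S_add: "x + y \<in> S" if "x \<in> S" "y \<in> S" for x y
    using F.Span_subgroup_props(3)[OF K, of Vs x y] that by (simp add: S_def)
  have S_zero: "0 \<in> S" using F.Span_subgroup_props(2)[OF K, of Vs] by (simp add: S_def)
  have S_smult: "k * x \<in> S" if "k \<in> ?K" "x \<in> S" for k x
    using F.Span_smult_closed[OF K, of Vs k x] that by (simp add: S_def)
  have S_sum: "sum g T \<in> S" if "finite T" "\<And>i. i \<in> T \<Longrightarrow> g i \<in> S" for T :: "'a set" and g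
    using that by (induction T) (auto intro: S_zero S_add)
  have CS: "to_fract c \<in> S" if "c \<in> Cs" for c
    using F.Span_base_incl[OF K, of ?U] Vs(3) that cs by (auto simp: S_def)
  have BS: "to_fract b \<in> S" if "b \<in> B" for b
  proof -
    obtain f where f: "f ` Cs \<subseteq> A" "b = (\<Sum>c\<in>Cs. f c * c)" using gen[OF \<open>b \<in> B\<close>] by blast
    have "to_fract b = (\<Sum>c\<in>Cs. to_fract (f c) * to_fract c)" unfolding f(2) by simp
    then show ?thesis using f(1) by (auto intro!: S_sum S_smult CS AK Cs(1))
  qed
  have indep: "\<forall>i<r. f i = 0" if f: "f ` {..<r} \<subseteq> A" "(\<Sum>i<r. f i * v i) = 0" for f
  proof -
    let ?Ks = "map (to_fract \<circ> f) [0..<r]"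
    have "F.combine ?Ks Vs = (\<Sum>i<r. to_fract (f i) * to_fract (v i))"
      using v by (simp add: combine_ring_on_UNIV r_def)
    also have "\<dots> = to_fract (\<Sum>i<r. f i * v i)" by simp
    finally have "F.combine ?Ks Vs = \<zero>\<^bsub>ring_on UNIV\<^esub>" using f by simp
    moreover have "set ?Ks \<subseteq> ?K" using f(1) AK by (auto simp: image_subset_iff)
    ultimately have "set (take (length Vs) ?Ks) \<subseteq> {\<zero>\<^bsub>ring_on UNIV\<^esub>}"
      using F.independent_imp_trivial_combine[OF K Vs(2)] by blast
    then show ?thesis by (auto simp: r_def image_subset_iff)
  qed
  have dimS: "F.dimension r ?K S" unfolding r_def S_def by (rule F.dimension_independent[OF Vs(2)])
  have LS: "?L \<subseteq> S"
  proof
    fix x assume "x \<in> ?L"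
    then obtain b b' where b: "b \<in> B" "b' \<in> B" "b' \<noteq> 0" "x = to_fract b / to_fract b'"
      by (auto simp: quot_field_iff)
    let ?W = "map ((*) (to_fract b')) Vs"
    have comb: "F.combine Ks ?W = to_fract b' * F.combine Ks Vs" if "length Ks = length Vs" for Ks
      using that by (simp add: combine_ring_on_UNIV sum_distrib_left mult.left_commute)
    have "F.independent ?K ?W"
    proof (rule F.trivial_combine_imp_independent[OF K])
      fix Ks assume Ks: "set Ks \<subseteq> ?K" "F.combine Ks ?W = \<zero>\<^bsub>ring_on UNIV\<^esub>"
      obtain Ks' where Ks': "set (take (length ?W) Ks) \<subseteq> set Ks'"
        "set Ks' \<subseteq> set (take (length ?W) Ks) \<union> {\<zero>\<^bsub>ring_on UNIV\<^esub>}" "length Ks' = length ?W"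
        "F.combine Ks' ?W = \<zero>\<^bsub>ring_on UNIV\<^esub>"
        using F.combine_normalize[of Ks ?W] Ks(2) by auto
      have "F.combine Ks' Vs = \<zero>\<^bsub>ring_on UNIV\<^esub>" using comb[of Ks'] Ks'(3,4) b(3) by simp
      moreover have "set Ks' \<subseteq> ?K"
        using Ks'(2) Ks(1) set_take_subset[of "length ?W" Ks] AK[OF subring_set_zero[OF A]] by auto
      ultimately have "set (take (length Vs) Ks') \<subseteq> {\<zero>\<^bsub>ring_on UNIV\<^esub>}"
        using F.independent_imp_trivial_combine[OF K Vs(2)] by blast
      then show "set (take (length ?W) Ks) \<subseteq> {\<zero>\<^bsub>ring_on UNIV\<^esub>}" using Ks'(1,3) by auto
    qed simp
    moreover have "set ?W \<subseteq> S"
    proof clarsimp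
      fix w assume "w \<in> set Vs"
      then obtain c where "c \<in> Cs" "w = to_fract c" using Vs(1) cs by auto
      then have "to_fract b' * w = to_fract (b' * c)" "b' * c \<in> B"
        using b(2) Cs(2) B by (auto simp: subring_set_def)
      then show "to_fract b' * w \<in> S" using BS by metis
    qed
    ultimately have "F.Span ?K ?W = S"
      using F.independent_length_eq_dimension[OF K dimS, of ?W] by (simp add: r_def)
    then have "to_fract b \<in> F.Span ?K ?W" using BS[OF b(1)] by simp
    then obtain Ks where Ks: "set Ks \<subseteq> ?K" "length Ks = length ?W" "to_fract b = F.combine Ks ?W"
      using F.Span_mem_iff_length_version[OF K, of ?W "to_fract b"] by auto
    then have "x = F.combine Ks Vs" using comb[of Ks] b by simp
    then show "x \<in> S"
      using F.Span_mem_iff_length_version[OF K, of Vs x] Ks(1,2) unfolding S_def by auto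
  qed
  have SL: "S \<subseteq> ?L"
  proof
    fix x assume "x \<in> S"
    then obtain k where k: "k ` {..<r} \<subseteq> ?K" "x = (\<Sum>i<r. k i * to_fract (v i))" using S_iff by blast
    have L: "subfield ?L (ring_on UNIV)" by (rule subfield_quot_field[OF B])
    note L' = subringE[OF subfieldE(1)[OF L], simplified]
    have KL: "?K \<subseteq> ?L" using sub by (auto simp: quot_field_def)
    have "to_fract c \<in> ?L" if "c \<in> Cs" for c
      using that Cs(2) B unfolding quot_field_iff
      by (intro bexI[of _ c] bexI[of _ 1]) (auto simp: subring_set_def)
    then have t: "k i * to_fract (v i) \<in> ?L" if "i < r" for i
      using that k(1) KL v[of i] by (intro L'(6)) auto
    have "(\<Sum>i<m. k i * to_fract (v i)) \<in> ?L" if "m \<le> r" for m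
      using that by (induction m) (use t L'(2,7) in auto)
    then show "x \<in> ?L" using k(2) by simp
  qed
  have S_eq: "S = ?L" using LS SL by blast
  have "domain_degree (ring_on A) (ring_on B) = enat r"
    unfolding domain_degree_def field_degree_def ring_on_UNIV
    using F.finite_dimensionI[OF dimS[unfolded S_eq]] F.dimI[OF K dimS[unfolded S_eq]]
    by (simp add: over_def)
  moreover have "r > 0"
  proof (rule ccontr)
    assume "\<not> r > 0"
    then have "Vs = []" by (simp add: r_def)
    then have "S = {0}" by (simp add: S_def)
    moreover have "1 \<in> B" using B by (simp add: subring_set_def)
    then have "to_fract 1 \<in> S" by (rule BS)
    ultimately show False by simp
  qed
  moreover have "\<forall>c\<in>Cs. \<exists>k. k ` {..<r} \<subseteq> ?K \<and> to_fract c = (\<Sum>i<r. k i * to_fract (v i))"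
    using CS S_iff by blast
  then obtain k where k: "\<And>c. c \<in> Cs \<Longrightarrow> k c ` {..<r} \<subseteq> ?K \<and> to_fract c = (\<Sum>i<r. k c i * to_fract (v i))"
    by metis
  have "(\<Union>c\<in>Cs. k c ` {..<r}) \<subseteq> ?K" using k by (intro UN_least) blast
  then obtain q where q: "q \<in> A" "q \<noteq> 0" "\<forall>x\<in>(\<Union>c\<in>Cs. k c ` {..<r}). \<exists>a\<in>A. to_fract q * x = to_fract a"
    using common_denominator[OF A, of "\<Union>c\<in>Cs. k c ` {..<r}"] Cs(1) by blast
  have "\<exists>f. f ` {..<r} \<subseteq> A \<and> q * c = (\<Sum>i<r. f i * v i)" if c: "c \<in> Cs" for c
  proof -
    have "\<forall>i<r. \<exists>a\<in>A. to_fract q * k c i = to_fract a" using q(3) c by blast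
    then obtain f where f: "\<And>i. i < r \<Longrightarrow> f i \<in> A \<and> to_fract q * k c i = to_fract (f i)" by metis
    have "to_fract (q * c) = (\<Sum>i<r. (to_fract q * k c i) * to_fract (v i))"
      using k[OF c] by (simp add: sum_distrib_left mult.assoc)
    also have "\<dots> = to_fract (\<Sum>i<r. f i * v i)" using f by simp
    finally have "q * c = (\<Sum>i<r. f i * v i)" using to_fract_eq_iff by blast
    then show ?thesis using f by (intro exI[of _ f]) auto
  qed
  ultimately show ?thesis
    using that[of r v q] v indep q(1,2) by blast
qed

section \<open>Finiteness over the subalgebra\<close>

lemma restr_homog_mult:
  fixes g b :: "('k::field) mpol"
  assumes g: "g \<in> homog_part s d" and "d \<le> t"
  shows "restr {m. exp_deg m = t} (g * b) = g * restr {m. exp_deg m = t - d} b"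
proof (induction b rule: mpol_induct)
  case (add c m q)
  have keys: "Poly_Mapping.keys (g * monom m) \<subseteq> {m'. exp_deg m' = d + exp_deg m}"
    by (rule keys_mult_subset[of g "{m'. exp_deg m' = d}" _ "{m}"])
      (use g homog_part_iff[of g s d] in \<open>auto simp: Exps_def exp_deg_add\<close>)
  have "restr {m. exp_deg m = t} (g * monom m) = g * restr {m. exp_deg m = t - d} (monom m)"
  proof (cases "exp_deg m = t - d")
    case True
    then have "restr {m. exp_deg m = t} (g * monom m) = g * monom m"
      by (intro restr_id) (use keys assms(2) in auto)
    then show ?thesis using True by (simp add: restr_id)
  next
    case False
    then have "restr {m. exp_deg m = t} (g * monom m) = 0"
      by (intro restr_empty) (use keys in fastforce)
    then show ?thesis using False by (simp add: restr_empty)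
  qed
  then show ?case
    using add by (simp add: distrib_left restr_add restr_smul smul_mult_right)
qed simp

text \<open>Because the generators are homogeneous, passing to the component of degree \<open>t\<close> of a combination
  of them only replaces each coefficient by its component of degree \<open>t - d\<close>.\<close>

lemma genideal_homog_piece:
  fixes Gs :: "('k::field) mpol set"
  assumes Gs: "Gs \<subseteq> homog_part s d" and p: "p \<in> Idl\<^bsub>mpol_ring s\<^esub> Gs" "p \<in> homog_part s t" and t: "d \<le> t"
  shows "p \<in> mp.span {v * b | v b. v \<in> Gs \<and> b \<in> homog_part s (t - d)}"
proof -
  let ?H = "{p :: 'k mpol. Poly_Mapping.keys p \<subseteq> Exps {..<s} (\<lambda>_. True)}"
  note sr = subring_set_mpol[of "{..<s}", where 'k = 'k]
  interpret R: cring "ring_on ?H" by (rule cring_ring_on[OF sr])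
  note cl = sr[unfolded subring_set_def]
  have GsH: "Gs \<subseteq> ?H"
  proof
    fix g assume "g \<in> Gs"
    then have "g \<in> homog_part s d" using Gs by blast
    then show "g \<in> ?H" by (auto simp: homog_part_iff Exps_def)
  qed
  let ?J = "mp.span {g * b | g b. g \<in> Gs \<and> b \<in> ?H}"
  have Hspan: "?H = mp.span (monom ` Exps {..<s} (\<lambda>_. True))" by (auto simp: span_monom_iff)
  have subH: "mp.subspace ?H" unfolding Hspan by simp
  have J: "ideal ?J (ring_on ?H)"
    unfolding ideal_ring_on[OF sr]
  proof (intro conjI ballI)
    show "?J \<subseteq> ?H" by (rule mp.span_minimal[OF _ subH]) (use GsH cl in blast)
    fix x a assume x: "x \<in> ?H" and a: "a \<in> ?J"
    show "x * a \<in> ?J"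
    proof (rule span_mult_closed[OF mp.span_base[of x "{x}"] a])
      fix y z assume "y \<in> {x}" "z \<in> {g * b | g b. g \<in> Gs \<and> b \<in> ?H}"
      then obtain g b where gb: "y = x" "z = g * b" "g \<in> Gs" "b \<in> ?H" by blast
      have "y * z = g * (x * b)" using gb by (simp add: mult.left_commute)
      moreover have "x * b \<in> ?H" using x gb(4) cl by blast
      ultimately show "y * z \<in> ?J" using gb(3) by (intro mp.span_base) blast
    qed simp
  qed (auto intro: mp.span_add mp.span_zero)
  have "Gs \<subseteq> ?J"
  proof
    fix g assume "g \<in> Gs"
    moreover have "1 \<in> ?H" using cl by blast
    ultimately have "g * 1 \<in> ?J" by (intro mp.span_base) blast
    then show "g \<in> ?J" by simp
  qed
  then have "Idl\<^bsub>ring_on ?H\<^esub> Gs \<subseteq> ?J" by (rule R.genideal_minimal[OF J])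
  then have "p \<in> ?J" using p(1) unfolding mpol_ring_on by blast
  then have "restr {m. exp_deg m = t} p \<in> mp.span {v * b | v b. v \<in> Gs \<and> b \<in> homog_part s (t - d)}"
  proof (induction rule: mp.span_induct_alt)
    case base
    show ?case by (simp add: mp.span_zero)
  next
    case (step c x y)
    then obtain g b where gb: "x = g * b" "g \<in> Gs" "b \<in> ?H" by blast
    have "restr {m. exp_deg m = t} x = g * restr {m. exp_deg m = t - d} b"
      unfolding gb(1) using Gs gb(2) t by (intro restr_homog_mult) auto
    moreover have "restr {m. exp_deg m = t - d} b \<in> homog_part s (t - d)"
      using gb(3) by (auto simp: homog_part_iff keys_restr Exps_def)
    ultimately have "restr {m. exp_deg m = t} x \<in> {v * b | v b. v \<in> Gs \<and> b \<in> homog_part s (t - d)}"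
      using gb(2) by blast
    then show ?case
      using step.IH by (simp add: restr_add restr_smul mp.span_add mp.span_scale mp.span_base)
  qed
  moreover have "restr {m. exp_deg m = t} p = p"
    using p(2) by (intro restr_id) (auto simp: homog_part_iff Exps_def)
  ultimately show ?thesis by simp
qed

text \<open>By the pigeonhole principle a monomial of degree at least \<open>s N\<close> is divisible by the \<open>N\<close>-th power of
  some variable.\<close>

lemma homog_part_subset_ideal:
  fixes J :: "('k::field) mpol set"
  assumes J: "ideal J (mpol_ring s)" and vars: "\<And>i. i < s \<Longrightarrow> mvar i ^ N \<in> J"
    and s: "s \<ge> 1" and t: "s * N \<le> t"
  shows "homog_part s t \<subseteq> J"
proof -
  let ?H = "{p :: 'k mpol. Poly_Mapping.keys p \<subseteq> Exps {..<s} (\<lambda>_. True)}"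
  note sr = subring_set_mpol[of "{..<s}", where 'k = 'k]
  note i = J[unfolded mpol_ring_on ideal_ring_on[OF sr]]
  have pow: "mvar i ^ n = monom (Poly_Mapping.single i n)" for i n
    by (induction n) (simp_all add: mvar_def mult_single single_add[symmetric])
  have mono: "monom m \<in> J" if m: "m \<in> Exps {..<s} (\<lambda>u. u = t)" for m
  proof -
    have "\<exists>i<s. N \<le> Poly_Mapping.lookup m i"
    proof (rule ccontr)
      assume "\<not> (\<exists>i<s. N \<le> Poly_Mapping.lookup m i)"
      then have "(\<Sum>i<s. Poly_Mapping.lookup m i) < (\<Sum>i<s. N)"
        using s by (intro sum_strict_mono) (auto simp: not_le lessThan_empty_iff bot_nat_def)
      then show False using m t exp_deg_superset[of "{..<s}" m] by (auto simp: Exps_def)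
    qed
    then obtain i where i': "i < s" "N \<le> Poly_Mapping.lookup m i" by blast
    let ?u = "Poly_Mapping.single i N"
    have mu: "m = (m - ?u) + ?u"
      using i' by (intro poly_mapping_eqI) (auto simp: lookup_add lookup_minus lookup_single when_def)
    have "Poly_Mapping.keys (m - ?u) \<subseteq> {..<s}"
      using m by (fastforce simp: in_keys_iff lookup_minus subset_iff Exps_def)
    then have "monom (m - ?u) \<in> ?H" by (auto simp: Exps_def)
    then have "monom (m - ?u) * mvar i ^ N \<in> J" using i vars[OF i'(1)] by blast
    then show ?thesis using mu by (simp add: pow mult_single)
  qed
  have "mp.subspace J"
  proof -
    have "smul c 1 \<in> ?H" for c by (auto simp: smul_def Exps_def)
    moreover have "smul c a = smul c 1 * a" for c a by (simp add: smul_def)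
    ultimately have "smul c a \<in> J" if "a \<in> J" for c a using i that by metis
    then show ?thesis using i by (auto simp: mp.subspace_def)
  qed
  then show ?thesis unfolding homog_part_span using mono by (intro mp.span_minimal) auto
qed

text \<open>A form of degree at least \<open>t\<^sub>0\<close> lies in the ideal, so it is a combination of products of a generator
  and a form of degree lower by \<open>d\<close>; repeating this leaves a factor of degree at most \<open>t\<^sub>0\<close>.\<close>

lemma primary_module_finite:
  fixes Gs :: "('k::field) mpol set"
  assumes Gs: "Gs \<subseteq> homog_part s d" and d: "d \<ge> 1" and s: "s \<ge> 1" and GV: "Gs \<subseteq> V"
    and rad: "radical (mpol_ring s) (Idl\<^bsub>mpol_ring s\<^esub> Gs) = max_homog_ideal s"
  obtains t0 where "module_finite V s d t0"
proof -
  let ?H = "{p :: 'k mpol. Poly_Mapping.keys p \<subseteq> Exps {..<s} (\<lambda>_. True)}"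
  note sr = subring_set_mpol[of "{..<s}", where 'k = 'k]
  interpret R: cring "mpol_ring s :: 'k mpol ring" unfolding mpol_ring_on by (rule cring_ring_on[OF sr])
  let ?J = "Idl\<^bsub>mpol_ring s\<^esub> Gs"
  have "Gs \<subseteq> carrier (mpol_ring s)"
    using Gs by (auto simp: homog_part_def)
  then have J: "ideal ?J (mpol_ring s)" by (rule R.genideal_ideal)
  note i = J[unfolded mpol_ring_on ideal_ring_on[OF sr], folded mpol_ring_on]
  have varH: "mvar i \<in> ?H" if "i < s" for i using that by (auto simp: mvar_def Exps_def)
  have "\<exists>n. mvar i ^ n \<in> ?J" if "i < s" for i
  proof -
    have "Poly_Mapping.single i (Suc 0) \<noteq> 0"
      using exp_deg_single[of i "Suc 0"] exp_deg_zero by (metis zero_neq_one One_nat_def)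
    then have "mvar i \<in> max_homog_ideal s"
      using varH[OF that] unfolding max_homog_ideal_eq by (simp add: mvar_def lookup_single when_def)
    then have "mvar i \<in> radical (mpol_ring s) ?J" using rad by simp
    then show ?thesis unfolding radical_def by (auto simp: mpol_ring_on nat_pow_ring_on)
  qed
  then obtain n where n: "\<And>i. i < s \<Longrightarrow> mvar i ^ n i \<in> ?J" by metis
  define N where "N = (\<Sum>i<s. n i)"
  have vars: "mvar i ^ N \<in> ?J" if "i < s" for i
  proof -
    have "n i \<le> N" unfolding N_def using that by (intro member_le_sum) auto
    then have "mvar i ^ N = mvar i ^ (N - n i) * mvar i ^ n i" by (simp flip: power_add)
    moreover have "mvar i ^ k \<in> ?H" for k
      using sr varH[OF that] by (induction k) (auto simp: subring_set_def)
    ultimately show ?thesis using i n[OF that] by metis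
  qed
  define t0 where "t0 = s * N + d"
  have step: "homog_part s t \<subseteq> mp.span {v * b | v b. v \<in> V \<and> b \<in> homog_part s (t - d)}" if "t0 \<le> t" for t
  proof
    fix p :: "'k mpol" assume p: "p \<in> homog_part s t"
    have "p \<in> ?J" using homog_part_subset_ideal[OF J vars s, of t] that p by (auto simp: t0_def)
    then have "p \<in> mp.span {v * b | v b. v \<in> Gs \<and> b \<in> homog_part s (t - d)}"
      using that p by (intro genideal_homog_piece[OF Gs]) (auto simp: t0_def)
    also have "\<dots> \<subseteq> mp.span {v * b | v b. v \<in> V \<and> b \<in> homog_part s (t - d)}"
      by (rule mp.span_mono) (use GV in blast)
    finally show "p \<in> mp.span {v * b | v b. v \<in> V \<and> b \<in> homog_part s (t - d)}" .
  qed
  have "module_finite V s d t0"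
    unfolding module_finite_def
  proof
    fix t
    show "\<exists>j. j * d \<le> t \<and> t - j * d \<le> t0 \<and>
      homog_part s t \<subseteq> mp.span {a * b |a b. a \<in> power_span V j \<and> b \<in> homog_part s (t - j * d)}"
    proof (induction t rule: less_induct)
      case (less t)
      show ?case
      proof (cases "t \<le> t0")
        case True
        have "p \<in> mp.span {a * b |a b. a \<in> power_span V 0 \<and> b \<in> homog_part s (t - 0 * d)}"
          if "p \<in> homog_part s t" for p
        proof -
          have "p = 1 * p" by simp
          then show ?thesis using one_in_power_span[of V] that by (intro mp.span_base) force
        qed
        then show ?thesis using True by (intro exI[of _ 0]) auto
      next
        case False
        then have dt: "d \<le> t" "t - d < t" "t0 \<le> t" using d by (auto simp: t0_def)
        obtain j where j: "j * d \<le> t - d" "t - d - j * d \<le> t0"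
          "homog_part s (t - d) \<subseteq> mp.span {a * b |a b. a \<in> power_span V j \<and> b \<in> homog_part s (t - d - j * d)}"
          using less.IH[OF dt(2)] by blast
        have eq: "t - Suc j * d = t - d - j * d" by simp
        let ?T = "mp.span {a * b |a b. a \<in> power_span V (Suc j) \<and> b \<in> homog_part s (t - Suc j * d)}"
        have "homog_part s t \<subseteq> mp.span {v * b | v b. v \<in> V \<and> b \<in> homog_part s (t - d)}" by (rule step[OF dt(3)])
        also have "\<dots> \<subseteq> ?T"
        proof (rule mp.span_minimal[OF _ mp.subspace_span], clarify)
          fix v b :: "'k mpol" assume v: "v \<in> V" and b: "b \<in> homog_part s (t - d)"
          show "v * b \<in> ?T"
          proof (rule span_mult_closed[OF mp.span_base[of v "{v}"] subsetD[OF j(3) b]])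
            fix x y assume "x \<in> {v}" "y \<in> {a * b |a b. a \<in> power_span V j \<and> b \<in> homog_part s (t - d - j * d)}"
            then obtain a b where ab: "x = v" "y = a * b" "a \<in> power_span V j" "b \<in> homog_part s (t - d - j * d)"
              by blast
            have "x * y = (a * v) * b" using ab by (simp add: mult_ac)
            moreover have "a * v \<in> power_span V (Suc j)" using ab(3) v by (auto intro: mp.span_base)
            ultimately show "x * y \<in> ?T" using ab(4) unfolding eq by (intro mp.span_base) blast
          qed simp
        qed
        finally show ?thesis using j(1,2) dt(1) unfolding eq[symmetric] by (intro exI[of _ "Suc j"]) auto
      qed
    qed
  qed
  then show ?thesis by (rule that)
qed

lemma power_span_Veronese:
  "power_span (homog_part s d) j = (homog_part s (j * d) :: ('k::field) mpol set)"
proof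
  show "power_span (homog_part s d) j \<subseteq> (homog_part s (j * d) :: 'k mpol set)"
    by (rule power_span_homog) simp
  show "homog_part s (j * d) \<subseteq> (power_span (homog_part s d) j :: 'k mpol set)"
  proof (induction j)
    case 0
    have "Exps {..<s} (\<lambda>t. t = 0) = {0}" by (auto simp: Exps_def exp_deg_eq_zero)
    then show ?case by (simp add: homog_part_span)
  next
    case (Suc j)
    have "monom m \<in> (power_span (homog_part s d) (Suc j) :: 'k mpol set)"
      if m: "m \<in> Exps {..<s} (\<lambda>t. t = Suc j * d)" for m
    proof -
      obtain a b where ab: "m = a + b" "exp_deg a = j * d"
        using exp_split[of "j * d" m] m by (auto simp: Exps_def)
      then have "exp_deg b = d" "Poly_Mapping.keys a \<subseteq> {..<s}" "Poly_Mapping.keys b \<subseteq> {..<s}"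
        using m by (auto simp: Exps_def exp_deg_add keys_add_nat)
      then have "monom a \<in> (power_span (homog_part s d) j :: 'k mpol set)" "monom b \<in> (homog_part s d :: 'k mpol set)"
        using ab(2) Suc by (auto simp: homog_part_iff Exps_def)
      then have "monom a * monom b \<in> (power_span (homog_part s d) (Suc j) :: 'k mpol set)"
        unfolding power_span.simps by (intro mp.span_base) blast
      then show ?thesis by (simp add: ab(1) mult_single)
    qed
    then show ?case
      unfolding homog_part_span[of s "Suc j * d"] using span_power_span[of "homog_part s d" "Suc j"]
      by (metis image_subsetI mp.span_mono)
  qed
qed

definition Veronese_exps :: "nat \<Rightarrow> nat \<Rightarrow> nat \<Rightarrow> (nat \<Rightarrow>\<^sub>0 nat) set" where
  "Veronese_exps s d n = Exps {..<s} (\<lambda>t. t \<in> (\<lambda>j. j * d) ` {..n})"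

lemma pieces_Veronese:
  "pieces (homog_part s d) {..n} = (mp.span (monom ` Veronese_exps s d n) :: ('k::field) mpol set)"
proof
  show "pieces (homog_part s d) {..n} \<subseteq> (mp.span (monom ` Veronese_exps s d n) :: 'k mpol set)"
    unfolding Veronese_exps_def by (rule pieces_keys) simp
  have "monom m \<in> (pieces (homog_part s d) {..n} :: 'k mpol set)" if m: "m \<in> Veronese_exps s d n" for m
  proof -
    obtain j where j: "j \<le> n" "exp_deg m = j * d" "Poly_Mapping.keys m \<subseteq> {..<s}"
      using m by (auto simp: Veronese_exps_def Exps_def)
    then have "monom m \<in> (power_span (homog_part s d) j :: 'k mpol set)"
      by (auto simp: power_span_Veronese homog_part_iff Exps_def)
    then show ?thesis using power_span_pieces[of j "{..n}" "homog_part s d"] j(1) by auto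
  qed
  then show "mp.span (monom ` Veronese_exps s d n) \<subseteq> (pieces (homog_part s d) {..n} :: 'k mpol set)"
    by (intro mp.span_minimal[OF _ subspace_pieces]) auto
qed

text \<open>Peeling off factors of degree \<open>d\<close> preserves divisibility of the degree by \<open>d\<close>, so module
  generators of \<open>R\<close> yield module generators of the Veronese ring, and no degree is exceeded on the
  way.\<close>

lemma Veronese_finite:
  fixes V :: "('k::field) mpol set"
  assumes V: "V \<subseteq> homog_part s d" "d \<ge> 1" and fin: "module_finite V s d t0"
  shows "pieces (homog_part s d) {..n} \<subseteq>
    mp.span {a * c | a c. a \<in> pieces V {..n} \<and> c \<in> monom ` Veronese_exps s d t0}"
  unfolding pieces_Veronese
proof (rule mp.span_minimal[OF _ mp.subspace_span], clarify)
  fix m assume "m \<in> Veronese_exps s d n"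
  then obtain i where i: "i \<le> n" "exp_deg m = i * d" "Poly_Mapping.keys m \<subseteq> {..<s}"
    by (auto simp: Veronese_exps_def Exps_def)
  obtain j where j: "j * d \<le> i * d" "i * d - j * d \<le> t0"
    "homog_part s (i * d) \<subseteq> mp.span {a * b |a b. a \<in> power_span V j \<and> b \<in> (homog_part s (i * d - j * d) :: 'k mpol set)}"
    using spec[OF fin[unfolded module_finite_def], of "i * d"] by blast
  have ji: "j \<le> i" using j(1) V(2) mult_le_cancel2[of j d i] by linarith
  have eq: "i * d - j * d = (i - j) * d" by (simp add: diff_mult_distrib)
  have "(i - j) * 1 \<le> (i - j) * d" by (rule mult_le_mono2) (rule V(2))
  then have small: "i - j \<le> t0" using j(2) eq by linarith
  let ?T = "mp.span {a * c |a c. a \<in> pieces V {..n} \<and> c \<in> monom ` Veronese_exps s d t0}"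
  have "monom m \<in> (homog_part s (i * d) :: 'k mpol set)" using i by (auto simp: homog_part_iff Exps_def)
  then have "monom m \<in> mp.span {a * b |a b. a \<in> power_span V j \<and> b \<in> (homog_part s ((i - j) * d) :: 'k mpol set)}"
    using j(3) unfolding eq by blast
  also have "\<dots> \<subseteq> ?T"
  proof (rule mp.span_minimal[OF _ mp.subspace_span], clarify)
    fix a b :: "'k mpol" assume a: "a \<in> power_span V j" and b: "b \<in> homog_part s ((i - j) * d)"
    have "Exps {..<s} (\<lambda>t. t = (i - j) * d) \<subseteq> Veronese_exps s d t0"
      using small by (auto simp: Veronese_exps_def Exps_def)
    then have "homog_part s ((i - j) * d) \<subseteq> (mp.span (monom ` Veronese_exps s d t0) :: 'k mpol set)"
      unfolding homog_part_span by (intro mp.span_mono image_mono)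
    then have "b \<in> mp.span (monom ` Veronese_exps s d t0)" using b by blast
    moreover have "a \<in> pieces V {..n}" using a power_span_pieces[of j "{..n}" V] ji i(1) by auto
    ultimately show "a * b \<in> ?T"
      by (intro span_mult_closed[OF mp.span_base[of a "{a}"]]) (auto intro: mp.span_base)
  qed
  finally show "monom m \<in> ?T" .
qed

lemma span_products_coeffs:
  assumes "mp.subspace W" "finite C" "b \<in> mp.span {a * c | a c. a \<in> W \<and> c \<in> C}"
  shows "\<exists>f. f ` C \<subseteq> W \<and> b = (\<Sum>c\<in>C. f c * c)"
  using assms(3)
proof (induction rule: mp.span_induct_alt)
  case base
  show ?case using mp.subspace_0[OF assms(1)] by (intro exI[of _ "\<lambda>_. 0"]) auto
next
  case (step k x y)
  then obtain f a c0 where f: "f ` C \<subseteq> W" "y = (\<Sum>c\<in>C. f c * c)" and a: "x = a * c0" "a \<in> W" "c0 \<in> C"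
    by blast
  let ?g = "\<lambda>c. (if c = c0 then smul k a else 0) + f c"
  have "?g ` C \<subseteq> W"
    using f(1) a(2) assms(1) by (auto intro!: mp.subspace_add mp.subspace_scale mp.subspace_0)
  moreover have "(\<Sum>c\<in>C. ?g c * c) = (\<Sum>c\<in>C. if c = c0 then smul k a * c else 0) + (\<Sum>c\<in>C. f c * c)"
    by (simp add: distrib_right sum.distrib if_distrib[of "\<lambda>x. x * _"] cong: if_cong)
  then have "(\<Sum>c\<in>C. ?g c * c) = smul k x + y"
    using assms(2) a f(2) by (simp add: sum.delta smul_mult_left)
  ultimately show ?case by (intro exI[of _ ?g]) simp
qed

section \<open>Comparing the two filtrations\<close>

lemma card_Veronese_exps:
  assumes "d \<ge> 1"
  shows "finite (Veronese_exps s d n)"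
    "card (Veronese_exps s d n) = (\<Sum>j\<le>n. (j * d + s - 1) choose (j * d))"
proof -
  have fin: "finite ((\<lambda>j. j * d) ` {..n})" by simp
  show "finite (Veronese_exps s d n)"
    unfolding Veronese_exps_def by (rule card_Exps_Union(1)) auto
  have inj: "inj_on (\<lambda>j. j * d) {..n}" using assms by (auto simp: inj_on_def)
  show "card (Veronese_exps s d n) = (\<Sum>j\<le>n. (j * d + s - 1) choose (j * d))"
    unfolding Veronese_exps_def card_Exps_Union(2)[OF finite_lessThan fin] sum.reindex[OF inj]
    by simp
qed

text \<open>The number of monomials of degree \<open>t\<close> is monotone in \<open>t\<close>.  Hence a sum over the multiples of
  \<open>d\<close> is, up to a shift by one block of length \<open>d\<close>, the \<open>d\<close>-th part of the sum over all degrees.\<close>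

lemma card_Veronese_exps_bounds:
  assumes d: "d \<ge> 1" and s: "s \<ge> 1"
  shows "n \<ge> 1 \<Longrightarrow> (real (n * d) - 1) ^ s \<le> real d * fact s * real (card (Veronese_exps s d n))"
    "real d * fact s * real (card (Veronese_exps s d n)) \<le> real ((n + 1) * d + s) ^ s"
proof -
  define h where "h t = (t + s - 1) choose t" for t
  have h_mono: "h a \<le> h b" if "a \<le> b" for a b
  proof -
    have "h t = (t + s - 1) choose (s - 1)" for t
      using binomial_symmetric[of t "t + s - 1"] s by (simp add: h_def)
    then show ?thesis using that by (simp add: binomial_right_mono)
  qed
  have h_sum: "(\<Sum>t\<le>n. h t) = (n + s) choose n" for n
  proof -
    obtain r where "s = Suc r" using s by (cases s) auto
    then show ?thesis using sum_choose_lower[of r n] by (simp add: h_def add.commute)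
  qed
  have block: "(\<Sum>t<n * d. h t) = (\<Sum>j<n. \<Sum>t\<in>{j * d..<j * d + d}. h t)" for n
    by (rule sum.nat_group[symmetric])
  have card: "card (Veronese_exps s d n) = (\<Sum>j\<le>n. h (j * d))"
    unfolding card_Veronese_exps(2)[OF d] h_def ..
  show "(real (n * d) - 1) ^ s \<le> real d * fact s * real (card (Veronese_exps s d n))" if "n \<ge> 1"
  proof -
    have nd: "n * d \<ge> 1" using that d by simp
    have "(\<Sum>t<n * d. h t) \<le> (\<Sum>j<n. d * h (Suc j * d))"
      unfolding block
    proof (rule sum_mono)
      fix j
      have "(\<Sum>t\<in>{j * d..<j * d + d}. h t) \<le> (\<Sum>t\<in>{j * d..<j * d + d}. h (Suc j * d))"
        by (intro sum_mono h_mono) auto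
      then show "(\<Sum>t\<in>{j * d..<j * d + d}. h t) \<le> d * h (Suc j * d)" by simp
    qed
    also have "\<dots> = d * (\<Sum>j<n. h (Suc j * d))" by (simp add: sum_distrib_left)
    also have "(\<Sum>j<n. h (Suc j * d)) \<le> (\<Sum>j<Suc n. h (j * d))"
      unfolding sum.lessThan_Suc_shift by simp
    finally have le: "(\<Sum>t<n * d. h t) \<le> d * card (Veronese_exps s d n)"
      by (simp add: card lessThan_Suc_atMost del: sum.lessThan_Suc)
    obtain k where "n * d = Suc k" using nd by (cases "n * d") auto
    then have "{..<n * d} = {..n * d - 1}" by (simp add: lessThan_Suc_atMost)
    then have eq: "(\<Sum>t<n * d. h t) = (n * d - 1 + s) choose (n * d - 1)" by (simp add: h_sum)
    have "(real (n * d) - 1) ^ s = real (n * d - 1) ^ s" using nd by (simp add: of_nat_diff)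
    also have "\<dots> \<le> fact s * real ((n * d - 1 + s) choose (n * d - 1))" by (rule choose_bounds)
    also have "\<dots> \<le> fact s * real (d * card (Veronese_exps s d n))"
      using le unfolding eq by (intro mult_left_mono of_nat_mono) auto
    finally show ?thesis by (simp add: mult_ac)
  qed
  have "d * card (Veronese_exps s d n) = (\<Sum>j<n + 1. d * h (j * d))"
    by (simp add: card sum_distrib_left lessThan_Suc_atMost)
  also have "\<dots> \<le> (\<Sum>t<(n + 1) * d. h t)"
    unfolding block
  proof (rule sum_mono)
    fix j
    have "(\<Sum>t\<in>{j * d..<j * d + d}. h (j * d)) \<le> (\<Sum>t\<in>{j * d..<j * d + d}. h t)"
      by (intro sum_mono h_mono) auto
    then show "d * h (j * d) \<le> (\<Sum>t\<in>{j * d..<j * d + d}. h t)" by simp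
  qed
  also have "\<dots> \<le> (\<Sum>t\<le>(n + 1) * d. h t)" by (intro sum_mono2) auto
  finally have le: "d * card (Veronese_exps s d n) \<le> ((n + 1) * d + s) choose ((n + 1) * d)"
    by (simp only: h_sum)
  have "real d * fact s * real (card (Veronese_exps s d n)) = fact s * real (d * card (Veronese_exps s d n))"
    by simp
  also have "\<dots> \<le> fact s * real (((n + 1) * d + s) choose ((n + 1) * d))"
    using le by (intro mult_left_mono of_nat_mono) auto
  also have "\<dots> \<le> real ((n + 1) * d + s) ^ s" by (rule choose_bounds)
  finally show "real d * fact s * real (card (Veronese_exps s d n)) \<le> real ((n + 1) * d + s) ^ s" .
qed

text \<open>With \<open>r = [B : A]\<close>, a free \<open>A\<close>-module of rank \<open>r\<close> embeds into \<open>B\<close>, and a nonzero multiple of \<open>B\<close>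
  embeds into it.  Both embeddings shift degrees by a bounded amount only, so the filtration
  steps of \<open>B\<close> have asymptotically \<open>r\<close> times the dimension of those of \<open>A\<close>.\<close>

lemma rank_comparison:
  fixes V :: "('k::field) mpol set"
  assumes V: "V \<subseteq> homog_part s d" "d \<ge> 1" and fin: "module_finite V s d t0"
  obtains r e f where
    "domain_degree (ring_on (pieces V UNIV)) (ring_on (pieces (homog_part s d) UNIV)) = enat r" "r > 0"
    "\<forall>n. r * mp.dim (pieces V {..n}) \<le> card (Veronese_exps s d (n + e))"
    "\<forall>n. card (Veronese_exps s d n) \<le> r * mp.dim (pieces V {..n + f})"
proof -
  let ?U = "homog_part s d :: 'k mpol set"
  define C where "C = (monom ` Veronese_exps s d t0 :: 'k mpol set)"
  have finC: "finite C" unfolding C_def using card_Veronese_exps(1)[OF V(2)] by simp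
  have VU: "pieces V T \<subseteq> pieces ?U T" for T
  proof -
    have "power_span V j \<subseteq> power_span ?U j" for j
      using power_span_homog[OF V(1)] by (simp add: power_span_Veronese)
    then show ?thesis unfolding pieces_def by (intro mp.span_mono) blast
  qed
  have CU: "C \<subseteq> pieces ?U UNIV"
  proof -
    have "C \<subseteq> pieces ?U {..t0}" unfolding C_def pieces_Veronese by (rule mp.span_superset)
    then show ?thesis using pieces_mono[of "{..t0}" UNIV ?U] by blast
  qed
  have gen_n: "\<exists>g. g ` C \<subseteq> pieces V {..n} \<and> b = (\<Sum>c\<in>C. g c * c)" if "b \<in> pieces ?U {..n}" for b n
    using span_products_coeffs[OF subspace_pieces finC] Veronese_finite[OF V fin, folded C_def] that by blast
  have gen: "\<exists>g. g ` C \<subseteq> pieces V UNIV \<and> b = (\<Sum>c\<in>C. g c * c)" if "b \<in> pieces ?U UNIV" for b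
  proof -
    obtain n where "b \<in> pieces ?U {..n}" by (rule pieces_bounded[OF \<open>b \<in> pieces ?U UNIV\<close>])
    then show ?thesis using gen_n[of b n] pieces_mono[of "{..n}" UNIV V] by blast
  qed
  obtain r v q where r: "domain_degree (ring_on (pieces V UNIV)) (ring_on (pieces ?U UNIV)) = enat r" "r > 0"
    and v: "v ` {..<r} \<subseteq> C"
    and ind: "\<forall>g. g ` {..<r} \<subseteq> pieces V UNIV \<longrightarrow> (\<Sum>i<r. g i * v i) = 0 \<longrightarrow> (\<forall>i<r. g i = 0)"
    and q: "q \<in> pieces V UNIV" "q \<noteq> 0"
    and qC: "\<forall>c\<in>C. \<exists>g. g ` {..<r} \<subseteq> pieces V UNIV \<and> q * c = (\<Sum>i<r. g i * v i)"
    by (rule domain_degree_basis[OF subring_set_pieces subring_set_pieces VU finC CU gen])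
  have basis: "\<exists>Bs. finite Bs \<and> Bs \<subseteq> pieces V {..n} \<and> mp.independent Bs \<and> pieces V {..n} \<subseteq> mp.span Bs
      \<and> card Bs = mp.dim (pieces V {..n})" for n
  proof -
    obtain F where F: "finite F" "pieces V {..n} \<subseteq> mp.span F"
      by (rule pieces_finite_span[OF V(1) finite_atMost])
    show ?thesis by (rule finite_basis[OF F]) blast
  qed
  have lower: "r * mp.dim (pieces V {..n}) \<le> card (Veronese_exps s d (n + t0))" for n
  proof -
    obtain Bs where Bs: "finite Bs" "Bs \<subseteq> pieces V {..n}" "mp.independent Bs" "card Bs = mp.dim (pieces V {..n})"
      using basis[of n] by blast
    have "ind_fam (Bs \<times> {..<r}) (\<lambda>(u, i). u * v i)"
      unfolding ind_fam_def
    proof (intro allI impI)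
      fix c :: "'k mpol \<times> nat \<Rightarrow> 'k"
      assume "(\<Sum>p\<in>Bs \<times> {..<r}. smul (c p) (case p of (u, i) \<Rightarrow> u * v i)) = 0"
      also have "(\<Sum>p\<in>Bs \<times> {..<r}. smul (c p) (case p of (u, i) \<Rightarrow> u * v i))
          = (\<Sum>u\<in>Bs. \<Sum>i<r. smul (c (u, i)) (u * v i))"
        by (simp add: sum.cartesian_product case_prod_beta)
      also have "\<dots> = (\<Sum>i<r. (\<Sum>u\<in>Bs. smul (c (u, i)) u) * v i)"
        by (subst sum.swap) (simp add: sum_distrib_right smul_mult_left)
      finally have "(\<Sum>i<r. (\<Sum>u\<in>Bs. smul (c (u, i)) u) * v i) = 0" .
      moreover have "(\<lambda>i. \<Sum>u\<in>Bs. smul (c (u, i)) u) ` {..<r} \<subseteq> pieces V UNIV"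
        using Bs(2) pieces_mono[of "{..n}" UNIV V] subspace_pieces[of V UNIV]
        by (auto intro!: mp.subspace_sum pieces_smul)
      ultimately have "\<forall>i<r. (\<Sum>u\<in>Bs. smul (c (u, i)) u) = 0" using ind by blast
      then show "\<forall>p\<in>Bs \<times> {..<r}. c p = 0"
        using independent_ind_fam[OF Bs(1,3)] unfolding ind_fam_def by auto
    qed
    moreover have "(\<lambda>(u, i). u * v i) ` (Bs \<times> {..<r}) \<subseteq> mp.span (monom ` Veronese_exps s d (n + t0))"
    proof clarify
      fix u i assume u: "u \<in> Bs" and i: "i < r"
      have "u \<in> pieces ?U {..n}" using Bs(2) VU u by blast
      moreover have "v i \<in> pieces ?U {..t0}"
        unfolding pieces_Veronese using v i by (auto simp: C_def image_subset_iff intro: mp.span_base)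
      ultimately have "u * v i \<in> pieces ?U {..n + t0}" by (rule pieces_mult) auto
      then show "u * v i \<in> mp.span (monom ` Veronese_exps s d (n + t0))" by (simp only: pieces_Veronese)
    qed
    moreover have "finite (monom ` Veronese_exps s d (n + t0) :: 'k mpol set)"
      using card_Veronese_exps(1)[OF V(2)] by simp
    ultimately have "card (Bs \<times> {..<r}) \<le> card (monom ` Veronese_exps s d (n + t0) :: 'k mpol set)"
      using ind_fam_card_le[of "Bs \<times> {..<r}"] Bs(1) by blast
    then show ?thesis
      using Bs(4) by (simp add: card_cartesian_product card_image inj_on_subset[OF inj_monom] mult.commute)
  qed
  obtain g where g: "\<And>c. c \<in> C \<Longrightarrow> g c ` {..<r} \<subseteq> pieces V UNIV \<and> q * c = (\<Sum>i<r. g c i * v i)"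
    using bchoice[OF qC] by blast
  have "(\<Union>c\<in>C. g c ` {..<r}) \<subseteq> pieces V UNIV" using g by (intro UN_least) blast
  then obtain f where f: "(\<Union>c\<in>C. g c ` {..<r}) \<subseteq> pieces V {..f}"
    using pieces_uniformly_bounded[of "\<Union>c\<in>C. g c ` {..<r}" V] finC by blast
  have upper: "card (Veronese_exps s d n) \<le> r * mp.dim (pieces V {..n + f})" for n
  proof -
    obtain Bs where Bs: "finite Bs" "pieces V {..n + f} \<subseteq> mp.span Bs" "card Bs = mp.dim (pieces V {..n + f})"
      using basis[of "n + f"] by blast
    define T where "T = (\<lambda>(u, i). u * v i) ` (Bs \<times> {..<r})"
    have q_span: "q * b \<in> mp.span T" if "b \<in> pieces ?U {..n}" for b
    proof -
      obtain h where h: "h ` C \<subseteq> pieces V {..n}" "b = (\<Sum>c\<in>C. h c * c)" using gen_n[OF \<open>b \<in> pieces ?U {..n}\<close>] by blast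
      have "q * b = (\<Sum>c\<in>C. h c * (q * c))" unfolding h(2) by (simp add: sum_distrib_left mult_ac)
      also have "\<dots> = (\<Sum>c\<in>C. \<Sum>i<r. (h c * g c i) * v i)"
        using g by (simp add: sum_distrib_left mult.assoc)
      also have "\<dots> \<in> mp.span T"
      proof (intro mp.span_sum)
        fix c i assume c: "c \<in> C" and i: "i \<in> {..<r}"
        have "h c \<in> pieces V {..n}" "g c i \<in> pieces V {..f}" using h(1) f c i by blast+
        then have "h c * g c i \<in> pieces V {..n + f}" by (rule pieces_mult) auto
        then have "h c * g c i \<in> mp.span Bs" using Bs(2) by blast
        then show "(h c * g c i) * v i \<in> mp.span T"
          by (rule span_mult_closed[OF _ mp.span_base[of "v i" "{v i}"]])
            (use i in \<open>auto simp: T_def intro!: mp.span_base\<close>)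
      qed
      finally show ?thesis .
    qed
    let ?M = "monom ` Veronese_exps s d n :: 'k mpol set"
    have finM: "finite ?M" using card_Veronese_exps(1)[OF V(2)] by simp
    have "ind_fam ?M (\<lambda>m. q * m)"
      unfolding ind_fam_def
    proof (intro allI impI)
      fix c assume "(\<Sum>m\<in>?M. smul (c m) (q * m)) = 0"
      then have "q * (\<Sum>m\<in>?M. smul (c m) m) = 0" by (simp add: sum_distrib_left smul_mult_right)
      then have "(\<Sum>m\<in>?M. smul (c m) m) = 0" using q(2) by (simp only: mult_eq_0_iff simp_thms)
      then show "\<forall>m\<in>?M. c m = 0"
        by (rule independent_ind_fam[OF finM independent_monom, unfolded ind_fam_def, rule_format, THEN ballI])
    qed
    moreover have "(\<lambda>m. q * m) ` ?M \<subseteq> mp.span T"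
      using q_span mp.span_superset[of ?M] unfolding pieces_Veronese by blast
    moreover have "finite T" using Bs(1) by (simp add: T_def)
    ultimately have "card ?M \<le> card T" by (rule ind_fam_card_le[OF finM])
    also have "card T \<le> card (Bs \<times> {..<r})" unfolding T_def using Bs(1) by (intro card_image_le) auto
    finally show ?thesis
      using Bs(3) by (simp add: card_cartesian_product card_image inj_on_subset[OF inj_monom] mult.commute)
  qed
  show ?thesis by (rule that[OF r]) (use lower upper in blast)+
qed

lemma affine_ratio_tendsto: "(\<lambda>n. ((real n * a + b) / real n) ^ s) \<longlonglongrightarrow> a ^ s"
proof (rule tendsto_power)
  have "(\<lambda>n. a + b / real n) \<longlonglongrightarrow> a + 0"
    by (intro tendsto_add tendsto_const lim_const_over_n)
  moreover have "eventually (\<lambda>n. a + b / real n = (real n * a + b) / real n) sequentially"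
    using eventually_gt_at_top[of "0::nat"] by eventually_elim (simp add: add_divide_distrib)
  ultimately have "(\<lambda>n. (real n * a + b) / real n) \<longlonglongrightarrow> a + 0"
    by (rule Lim_transform_eventually)
  then show "(\<lambda>n. (real n * a + b) / real n) \<longlonglongrightarrow> a" by simp
qed

text \<open>The dimensions below degree \<open>n\<close>, multiplied by \<open>r d s!\<close>, are squeezed between \<open>s\<close>-th powers of
  two functions that both differ from \<open>n d\<close> by a constant.\<close>

lemma multiplicity_pieces:
  fixes V :: "('k::field) mpol set"
  assumes V: "V \<subseteq> homog_part s d" "d \<ge> 1" and s: "s \<ge> 1" and fin: "module_finite V s d t0"
  obtains r where
    "domain_degree (ring_on (pieces V UNIV)) (ring_on (pieces (homog_part s d) UNIV)) = enat r" "r > 0"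
    "graded_multiplicity s (ring_on (pieces V UNIV)) = real (d ^ (s - 1)) / real r"
proof -
  let ?A = "ring_on (pieces V UNIV)"
  obtain r e f where r: "domain_degree ?A (ring_on (pieces (homog_part s d) UNIV)) = enat r" "r > 0"
    and lo: "\<forall>n. r * mp.dim (pieces V {..n}) \<le> card (Veronese_exps s d (n + e))"
    and up: "\<forall>n. card (Veronese_exps s d n) \<le> r * mp.dim (pieces V {..n + f})"
    by (rule rank_comparison[OF V fin])
  define D where "D n = mp.dim (pieces V {..<n})" for n
  define x where "x n = fact s * real (D n) / real n ^ s" for n
  have mult: "graded_multiplicity s ?A = lim x"
    unfolding graded_multiplicity_def multiplicity_wrt_def x_def D_def
    by (simp add: krull_dim_pieces[OF V fin] irrelevant_ideal_eq[OF V] irrelevant_ideal_power[unfolded One_nat_def]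
        ring_length_irrelevant_power[OF V])
  have bounds: "((real n * real d + (- real (Suc f * d) - 1)) / real n) ^ s \<le> real (r * d) * x n"
    "real (r * d) * x n \<le> ((real n * real d + real (e * d + s)) / real n) ^ s" if n: "n \<ge> f + 2" for n
  proof -
    obtain m where m: "n = Suc m" "m \<ge> f + 1" using n by (cases n) auto
    have D: "D n = mp.dim (pieces V {..m})" by (simp add: D_def m lessThan_Suc_atMost)
    have x_eq: "real (r * d) * x n = real d * fact s * real (r * D n) / real n ^ s"
      by (simp add: x_def)
    have nf: "n - Suc f \<ge> 1" "n - Suc f + f = m" using m by auto
    have "(real n * real d + (- real (Suc f * d) - 1)) ^ s = (real ((n - Suc f) * d) - 1) ^ s"
    proof -
      have le: "Suc f \<le> n" using n by simp
      have "real ((n - Suc f) * d) = real n * real d - real (Suc f * d)"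
        by (simp only: of_nat_mult of_nat_diff[OF le] left_diff_distrib)
      then have "real n * real d + (- real (Suc f * d) - 1) = real ((n - Suc f) * d) - 1" by linarith
      then show ?thesis by (rule arg_cong)
    qed
    also have "\<dots> \<le> real d * fact s * real (card (Veronese_exps s d (n - Suc f)))"
      by (rule card_Veronese_exps_bounds(1)[OF V(2) s nf(1)])
    also have "\<dots> \<le> real d * fact s * real (r * D n)"
      using spec[OF up, of "n - Suc f"] unfolding nf(2) D by (intro mult_left_mono of_nat_mono) auto
    finally show "((real n * real d + (- real (Suc f * d) - 1)) / real n) ^ s \<le> real (r * d) * x n"
      unfolding x_eq power_divide by (rule divide_right_mono) simp
    have "real d * fact s * real (r * D n) \<le> real d * fact s * real (card (Veronese_exps s d (m + e)))"
      using spec[OF lo, of m] unfolding D by (intro mult_left_mono of_nat_mono) auto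
    also have "\<dots> \<le> real ((m + e + 1) * d + s) ^ s"
      by (rule card_Veronese_exps_bounds(2)[OF V(2) s])
    also have "\<dots> = (real n * real d + real (e * d + s)) ^ s" by (simp add: m algebra_simps)
    finally show "real (r * d) * x n \<le> ((real n * real d + real (e * d + s)) / real n) ^ s"
      unfolding x_eq power_divide by (rule divide_right_mono) simp
  qed
  have "(\<lambda>n. real (r * d) * x n) \<longlonglongrightarrow> real d ^ s"
  proof (rule tendsto_sandwich)
    show "\<forall>\<^sub>F n in sequentially. ((real n * real d + (- real (Suc f * d) - 1)) / real n) ^ s \<le> real (r * d) * x n"
      using eventually_ge_at_top[of "f + 2"] by eventually_elim (rule bounds)
    show "\<forall>\<^sub>F n in sequentially. real (r * d) * x n \<le> ((real n * real d + real (e * d + s)) / real n) ^ s"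
      using eventually_ge_at_top[of "f + 2"] by eventually_elim (rule bounds)
  qed (rule affine_ratio_tendsto)+
  then have "(\<lambda>n. real (r * d) * x n / real (r * d)) \<longlonglongrightarrow> real d ^ s / real (r * d)"
    using r(2) V(2) by (intro tendsto_divide tendsto_const) auto
  moreover have "real (r * d) * x n / real (r * d) = x n" for n using r(2) V(2) by simp
  moreover have "real d ^ s / real (r * d) = real (d ^ (s - 1)) / real r"
  proof -
    obtain u where "s = Suc u" using s by (cases s) auto
    then show ?thesis using V(2) by simp
  qed
  ultimately have "x \<longlonglongrightarrow> real (d ^ (s - 1)) / real r" by simp
  then have "graded_multiplicity s ?A = real (d ^ (s - 1)) / real r" unfolding mult by (rule limI)
  then show ?thesis by (rule that[OF r])
qed

text \<open>A form of degree zero is a constant, so an ideal generated by such forms is zero or the whole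
  ring; in at least one variable neither is primary to the maximal homogeneous ideal.\<close>

lemma primary_degree_positive:
  fixes Gs :: "('k::field) mpol set"
  assumes Gs: "Gs \<subseteq> homog_part s d" and s: "s \<ge> 1"
    and prim: "primary_to (max_homog_ideal s) (Idl\<^bsub>mpol_ring s\<^esub> Gs) (mpol_ring s)"
  shows "d \<ge> 1"
proof (rule ccontr)
  assume "\<not> d \<ge> 1"
  then have d: "d = 0" by simp
  let ?H = "{p :: 'k mpol. Poly_Mapping.keys p \<subseteq> Exps {..<s} (\<lambda>_. True)}"
  let ?J = "Idl\<^bsub>mpol_ring s\<^esub> Gs"
  note sr = subring_set_mpol[of "{..<s}", where 'k = 'k]
  interpret R: cring "mpol_ring s :: 'k mpol ring" unfolding mpol_ring_on by (rule cring_ring_on[OF sr])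
  have GsR: "Gs \<subseteq> carrier (mpol_ring s)" using Gs by (auto simp: homog_part_def)
  have J: "ideal ?J (mpol_ring s)" using GsR by (rule R.genideal_ideal)
  note i = J[unfolded mpol_ring_on ideal_ring_on[OF sr], folded mpol_ring_on]
  have J_ne: "?J \<noteq> ?H" using prim by (simp add: primary_to_def primary_ideal_def mpol_ring_on)
  have "Gs \<subseteq> {0}"
  proof (rule ccontr)
    assume "\<not> Gs \<subseteq> {0}"
    then obtain g where g: "g \<in> Gs" "g \<noteq> 0" by auto
    have "Exps {..<s} (\<lambda>t. t = 0) = {0}" by (auto simp: Exps_def exp_deg_eq_zero)
    then have "g \<in> mp.span {1}" using g(1) Gs d by (auto simp: homog_part_span)
    then obtain c where c: "g = smul c 1" by (auto simp: mp.span_singleton)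
    have "Poly_Mapping.single 0 (inverse c) * g \<in> ?J"
      using i R.genideal_self[OF GsR] g(1) by (auto simp: Exps_def)
    moreover have "Poly_Mapping.single 0 (inverse c) * g = 1"
    proof -
      have "c \<noteq> 0" using c g(2) by auto
      then show ?thesis using c by (simp add: smul_def mult_single)
    qed
    ultimately have "1 \<in> ?J" by simp
    then have "x \<in> ?J" if "x \<in> ?H" for x using i that by (metis mult.right_neutral)
    then show False using i J_ne by blast
  qed
  moreover have "ideal {0 :: 'k mpol} (mpol_ring s)"
    unfolding mpol_ring_on ideal_ring_on[OF sr] by simp
  ultimately have J0: "?J \<subseteq> {0}" by (intro R.genideal_minimal)
  have "Poly_Mapping.single 0 (Suc 0) \<noteq> (0 :: nat \<Rightarrow>\<^sub>0 nat)"
    using exp_deg_single[of 0 "Suc 0"] exp_deg_zero by (metis zero_neq_one One_nat_def)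
  then have "(mvar 0 :: 'k mpol) \<in> max_homog_ideal s"
    using s unfolding max_homog_ideal_eq by (auto simp: mvar_def lookup_single when_def Exps_def)
  then obtain n where "(mvar 0 :: 'k mpol) ^ n \<in> ?J"
    using prim unfolding primary_to_def radical_def by (auto simp: mpol_ring_on nat_pow_ring_on)
  then have "(mvar 0 :: 'k mpol) ^ n = 0" using J0 by blast
  then have "(mvar 0 :: 'k mpol) = 0" by simp
  then show False by (metis mvar_def keys_single keys_zero insert_not_empty zero_neq_one)
qed

theorem mainTheorem9:
  fixes s n d :: nat
    and gs :: "('k::field) mpol list"
    and I :: "'k mpol set"
    and A B :: "'k mpol ring"
  assumes "infinite (UNIV :: 'k set)"
    and "s \<ge> 1"
    and "length gs = n"
    and "set gs \<subseteq> homog_part s d"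
    and "ring.independent (mpol_ring s) constants gs"
    and "I = Idl\<^bsub>mpol_ring s\<^esub> (set gs)"
    and "A = subalg_ring s (I \<inter> homog_part s d)"
    and "B = subalg_ring s (homog_part s d)"
    and "primary_to (max_homog_ideal s) I (mpol_ring s)"
  shows "ereal (real (d ^ (s - 1))) =
    ereal (graded_multiplicity s A) * ereal_of_enat (domain_degree A B)"
proof -
  interpret R: cring "mpol_ring s :: 'k mpol ring"
    unfolding mpol_ring_on by (rule cring_ring_on[OF subring_set_mpol])
  have d: "d \<ge> 1" using primary_degree_positive[OF assms(4,2)] assms(6,9) by simp
  define V where "V = I \<inter> homog_part s d"
  have V: "V \<subseteq> homog_part s d" by (simp add: V_def)
  have "set gs \<subseteq> I"
    unfolding assms(6) using assms(4) by (intro R.genideal_self) (auto simp: homog_part_def)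
  then have gsV: "set gs \<subseteq> V" using assms(4) by (simp add: V_def)
  have "radical (mpol_ring s) (Idl\<^bsub>mpol_ring s\<^esub> (set gs)) = max_homog_ideal s"
    using assms(6,9) by (simp add: primary_to_def)
  then obtain t0 where fin: "module_finite V s d t0"
    by (rule primary_module_finite[OF assms(4) d assms(2) gsV])
  obtain r where r: "domain_degree (ring_on (pieces V UNIV)) (ring_on (pieces (homog_part s d) UNIV)) = enat r"
    "r > 0" "graded_multiplicity s (ring_on (pieces V UNIV)) = real (d ^ (s - 1)) / real r"
    by (rule multiplicity_pieces[OF V d assms(2) fin])
  have "A = ring_on (pieces V UNIV)" "B = ring_on (pieces (homog_part s d) UNIV)"
    using assms(7,8) subalg_ring_pieces[OF V] subalg_ring_pieces[OF order_refl] by (simp_all add: V_def)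
  then show ?thesis using r by simp
qed

end
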